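(* Let $p$ be a prime and $k$ an integer, and suppose that either $k\ge 3$, or $k=2$ and $p\ge 5$. Put \[ d_{p,k}=\left\lceil\frac{p^{k+1}-1}{(k+1)(p-1)}\right\rceil . \] For every integer $r$ with \[ d_{p,k}\le r\le\left\lfloor\frac{p^k}{2}\right\rfloor \] there is a simple $\mathbb{F}_{p^k}$-representable matroid $M_{p,k,r}$ such that \[ a(M_{p,k,r})=r,\qquad p^k>2r-1,\qquad \chi_{M_{p,k,r}}(p^k)=0. \]
   Context: All matroids are finite. For a loopless matroid $M$, $\operatorname{si}(M)$ denotes its simplification, and $a(M)$ is the least number of independent sets of $\operatorname{si}(M)$ needed to cover its ground set (so for simple $M$ it is the least number of independent sets of $M$ covering $E(M)$). If $M$ has rank $n$ and rank function $\operatorname{rk}_M$, its characteristic polynomial is $\chi_M(t)=\sum_{A\subseteq E(M)}(-1)^{|A|}t^{\,n-\operatorname{rk}_M(A)}$. *)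

theory Defs
  imports "HOL-Algebra.Ring" "HOL-Computational_Algebra.Primes"
    "HOL-Computational_Algebra.Polynomial"
begin

locale matroid =
  fixes E :: "'a set" and indep :: "'a set \<Rightarrow> bool"
  assumes finite_ground: "finite E"
    and indep_subset_ground: "indep X \<Longrightarrow> X \<subseteq> E"
    and indep_empty: "indep {}"
    and indep_subset: "indep X \<Longrightarrow> Y \<subseteq> X \<Longrightarrow> indep Y"
    and indep_augment:
      "indep X \<Longrightarrow> indep Y \<Longrightarrow> card X < card Y \<Longrightarrow> \<exists>y\<in>Y - X. indep (insert y X)"

definition matroid_rank :: "('a set \<Rightarrow> bool) \<Rightarrow> 'a set \<Rightarrow> nat" where
  "matroid_rank indep A = Max (card ` {X. X \<subseteq> A \<and> indep X})"

definition matroid_loop :: "('a set \<Rightarrow> bool) \<Rightarrow> 'a \<Rightarrow> bool" where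
  "matroid_loop indep e \<longleftrightarrow> \<not> indep {e}"

definition matroid_parallel :: "('a set \<Rightarrow> bool) \<Rightarrow> 'a \<Rightarrow> 'a \<Rightarrow> bool" where
  "matroid_parallel indep x y \<longleftrightarrow>
     x \<noteq> y \<and> \<not> matroid_loop indep x \<and> \<not> matroid_loop indep y \<and> \<not> indep {x, y}"

definition matroid_simple :: "'a set \<Rightarrow> ('a set \<Rightarrow> bool) \<Rightarrow> bool" where
  "matroid_simple E indep \<longleftrightarrow>
     (\<forall>e\<in>E. \<not> matroid_loop indep e) \<and> (\<forall>x\<in>E. \<forall>y\<in>E. \<not> matroid_parallel indep x y)"

definition parallel_rel :: "'a set \<Rightarrow> ('a set \<Rightarrow> bool) \<Rightarrow> ('a \<times> 'a) set" where
  "parallel_rel E indep =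
     {(x, y). x \<in> {e\<in>E. \<not> matroid_loop indep e} \<and> y \<in> {e\<in>E. \<not> matroid_loop indep e}
        \<and> (x = y \<or> matroid_parallel indep x y)}"

text \<open>The simplification is realised as the restriction of the matroid to a chosen set of
  representatives of the parallel classes; up to isomorphism the choice is irrelevant.\<close>

definition si_ground :: "'a set \<Rightarrow> ('a set \<Rightarrow> bool) \<Rightarrow> 'a set" where
  "si_ground E indep =
     (\<lambda>C. SOME x. x \<in> C) ` ({e\<in>E. \<not> matroid_loop indep e} // parallel_rel E indep)"

definition si_indep :: "'a set \<Rightarrow> ('a set \<Rightarrow> bool) \<Rightarrow> 'a set \<Rightarrow> bool" where
  "si_indep E indep X \<longleftrightarrow> X \<subseteq> si_ground E indep \<and> indep X"

definition indep_cover_number :: "'a set \<Rightarrow> ('a set \<Rightarrow> bool) \<Rightarrow> nat" where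
  "indep_cover_number E indep =
     (LEAST m. \<exists>\<C>. finite \<C> \<and> card \<C> = m \<and> (\<forall>X\<in>\<C>. indep X) \<and> \<Union>\<C> = E)"

text \<open>The invariant \<open>a(M)\<close>; for simple matroids it is the cover number of the matroid itself.\<close>

definition matroid_a :: "'a set \<Rightarrow> ('a set \<Rightarrow> bool) \<Rightarrow> nat" where
  "matroid_a E indep = indep_cover_number (si_ground E indep) (si_indep E indep)"

definition char_poly_matroid :: "'a set \<Rightarrow> ('a set \<Rightarrow> bool) \<Rightarrow> int poly" where
  "char_poly_matroid E indep =
     (\<Sum>A\<in>Pow E. monom ((-1) ^ card A) (matroid_rank indep E - matroid_rank indep A))"

text \<open>Linear independence of the family (not the set) of columns indexed by \<open>X\<close> of the matrix
  \<open>A\<close> with rows \<open>0, \<dots>, m - 1\<close>; equal columns at distinct indices are therefore dependent.\<close>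

definition columns_independent ::
    "('f, 'm) ring_scheme \<Rightarrow> nat \<Rightarrow> (nat \<Rightarrow> 'a \<Rightarrow> 'f) \<Rightarrow> 'a set \<Rightarrow> bool" where
  "columns_independent F m A X \<longleftrightarrow>
     (\<forall>c \<in> X \<rightarrow> carrier F.
        (\<forall>i<m. (\<Oplus>\<^bsub>F\<^esub>e\<in>X. c e \<otimes>\<^bsub>F\<^esub> A i e) = \<zero>\<^bsub>F\<^esub>) \<longrightarrow> (\<forall>e\<in>X. c e = \<zero>\<^bsub>F\<^esub>))"

definition matroid_representable ::
    "('f, 'm) ring_scheme \<Rightarrow> 'a set \<Rightarrow> ('a set \<Rightarrow> bool) \<Rightarrow> bool" where
  "matroid_representable F E indep \<longleftrightarrow>
     (\<exists>m A. (\<forall>i<m. \<forall>e\<in>E. A i e \<in> carrier F) \<and>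
        (\<forall>X\<subseteq>E. indep X \<longleftrightarrow> columns_independent F m A X))"

definition d_bound :: "nat \<Rightarrow> nat \<Rightarrow> int" where
  "d_bound p k = \<lceil>(real p ^ (k + 1) - 1) / (real (k + 1) * (real p - 1))\<rceil>"

end

theory Submission
  imports Defs "HOL-Algebra.Subrings"
begin

text \<open>Write \<open>q = p\<^sup>k\<close> and let \<open>K\<close> be the prime subfield of \<open>F\<close>. The value at \<open>q\<close> of the
  characteristic polynomial of a set \<open>E\<close> of points of \<open>PG(k, q)\<close> vanishes as soon as every linear
  functional has a zero on \<open>E\<close>. This holds for the subgeometry \<open>PG(k, p)\<close>, because a functional
  restricted to the \<open>p\<^sup>k\<^sup>+\<^sup>1\<close> vectors over \<open>K\<close> cannot be injective, and hence for every larger set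
  of points. Since a set of rank \<open>j\<close> in \<open>PG(k, p)\<close> has at most \<open>(p\<^sup>j - 1) / (p - 1)\<close> elements,
  Edmonds' covering theorem covers \<open>PG(k, p)\<close> by \<open>d_bound p k\<close> independent sets. Adding a point
  raises the cover number by at most one, and that of the full \<open>PG(k, q)\<close> is at least \<open>r\<close>, so some
  intermediate set of points has cover number exactly \<open>r\<close>.\<close>

section \<open>Covering a matroid by independent sets\<close>

text \<open>The lower bound on \<open>r\<close> is Edmonds' inequality for PG(k, p) as a whole;
  smaller ranks ask for nothing stronger because (p^j - 1) / j increases with j. The number of
  coordinates k + 1 is the least m for which p^m exceeds q, as the pigeonhole argument requires. The
  upper bound on \<open>r\<close> serves twice: it gives q > 2r - 1, and it keeps fewer than
  \<open>r\<close> sets of at most k + 1 points each from exhausting PG(k, q). Independence is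
  witnessed by dual families of functionals rather than by vanishing relations: such a family over
  \<open>K\<close> is literally one over \<open>F\<close>, and it makes rank computable by counting
  annihilators, from which both augmentation and the characteristic polynomial follow.\<close>

context matroid
begin

section \<open>Rank, closure and exchange from the independence axioms\<close>

lemma finite_indep: "indep X \<Longrightarrow> finite X"
  using finite_ground finite_subset indep_subset_ground by blast

lemma card_le_matroid_rank:
  assumes "A \<subseteq> E" "indep X" "X \<subseteq> A"
  shows "card X \<le> matroid_rank indep A"
proof -
  have "finite A" using assms(1) finite_ground finite_subset by blast
  then have "finite {X. X \<subseteq> A \<and> indep X}" by simp
  then show ?thesis unfolding matroid_rank_def using assms by (intro Max_ge) auto
qed

lemma basis_exists:
  assumes "A \<subseteq> E"
  obtains B where "B \<subseteq> A" "indep B" "card B = matroid_rank indep A"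
proof -
  have "finite A" using assms finite_ground finite_subset by blast
  then have "finite {X. X \<subseteq> A \<and> indep X}" by simp
  moreover have "{} \<in> {X. X \<subseteq> A \<and> indep X}" using indep_empty by simp
  ultimately have "matroid_rank indep A \<in> card ` {X. X \<subseteq> A \<and> indep X}"
    unfolding matroid_rank_def by (intro Max_in) auto
  then show ?thesis using that by auto
qed

lemma matroid_rank_eqI:
  assumes "A \<subseteq> E" "B \<subseteq> A" "indep B" "\<And>x. x \<in> A - B \<Longrightarrow> \<not> indep (insert x B)"
  shows "matroid_rank indep A = card B"
proof (rule antisym)
  obtain C where C: "C \<subseteq> A" "indep C" "card C = matroid_rank indep A"
    using basis_exists assms(1) by blast
  show "matroid_rank indep A \<le> card B"
  proof (rule ccontr)
    assume "\<not> matroid_rank indep A \<le> card B"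
    then obtain y where "y \<in> C - B" "indep (insert y B)"
      using indep_augment[OF assms(3) C(2)] C(3) by auto
    then show False using assms(4) C(1) by blast
  qed
qed (use assms card_le_matroid_rank in blast)

text \<open>The usual matroid closure, given by a single independent witness \<open>X\<close>
  instead of by rank, so that monotonicity is immediate. Loops enter through
  \<open>X = {}\<close>.\<close>

definition cl :: "'a set \<Rightarrow> 'a set" where
  "cl A = A \<union> {x\<in>E. \<exists>X\<subseteq>A. indep X \<and> \<not> indep (insert x X)}"

lemma cl_mono: "A \<subseteq> B \<Longrightarrow> cl A \<subseteq> cl B"
  unfolding cl_def by blast

lemma subset_cl: "A \<subseteq> cl A"
  unfolding cl_def by blast

lemma extend_indep:
  assumes "A \<subseteq> E" "indep X" "X \<subseteq> A"
  obtains B where "X \<subseteq> B" "B \<subseteq> A" "indep B" "card B = matroid_rank indep A"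
proof -
  define S where "S = {Y. X \<subseteq> Y \<and> Y \<subseteq> A \<and> indep Y}"
  have "finite A" using assms finite_ground finite_subset by blast
  then have "finite S" unfolding S_def by auto
  moreover have "X \<in> S" unfolding S_def using assms by simp
  ultimately obtain B where B: "B \<in> S" "\<And>Y. Y \<in> S \<Longrightarrow> B \<subseteq> Y \<Longrightarrow> B = Y"
    using finite_has_maximal[of S] by blast
  have "\<not> indep (insert x B)" if "x \<in> A - B" for x
  proof
    assume "indep (insert x B)"
    then have "insert x B \<in> S" using B(1) that unfolding S_def by blast
    then show False using B(2)[of "insert x B"] that by blast
  qed
  then have "matroid_rank indep A = card B"
    using matroid_rank_eqI[OF assms(1), of B] B(1) unfolding S_def by blast
  then show ?thesis using that B(1) unfolding S_def by auto
qed

text \<open>The closure witness \<open>X\<close> may be unrelated to \<open>B\<close>, so it is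
  extended to another basis \<open>C\<close> of \<open>A\<close>. Were \<open>insert x B\<close>
  independent, augmentation would add one of its elements to \<open>C\<close>. That element is not
  \<open>x\<close>, since \<open>X\<close> already makes \<open>x\<close> dependent, so it lies in
  \<open>A\<close> and makes \<open>C\<close> too large.\<close>

lemma basis_spans:
  assumes "A \<subseteq> E" "B \<subseteq> A" "indep B" "card B = matroid_rank indep A" "x \<in> cl A" "x \<notin> B"
  shows "\<not> indep (insert x B)"
proof
  assume ind: "indep (insert x B)"
  then have gt: "card (insert x B) = Suc (card B)"
    using assms(3,6) finite_indep by simp
  have "x \<notin> A"
    using card_le_matroid_rank[OF assms(1) ind] gt assms(2,4) by auto
  then obtain X where X: "X \<subseteq> A" "indep X" "\<not> indep (insert x X)"
    using assms(5) unfolding cl_def by blast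
  obtain C where C: "X \<subseteq> C" "C \<subseteq> A" "indep C" "card C = matroid_rank indep A"
    using extend_indep[OF assms(1) X(2,1)] by blast
  obtain y where y: "y \<in> insert x B - C" "indep (insert y C)"
    using indep_augment[OF C(3) ind] gt C(4) assms(4) by auto
  have "y \<noteq> x" using y(2) X(3) C(1) indep_subset by (metis insert_mono)
  then have "insert y C \<subseteq> A" using y(1) C(2) assms(2) by auto
  then have "card (insert y C) \<le> card C"
    using card_le_matroid_rank[OF assms(1) y(2)] C(4) by simp
  then show False using y(1) finite_indep[OF C(3)] by simp
qed

lemma cl_subset_ground: "A \<subseteq> E \<Longrightarrow> cl A \<subseteq> E"
  unfolding cl_def by blast

text \<open>A basis \<open>B\<close> of \<open>A\<close> stays maximal in \<open>cl A\<close>, hence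
  is a basis there too. So \<open>B\<close>, a subset of \<open>A\<close>, is a closure witness even
  for elements of the second closure.\<close>

lemma cl_idem:
  assumes "A \<subseteq> E"
  shows "cl (cl A) = cl A"
proof -
  obtain B where B: "B \<subseteq> A" "indep B" "card B = matroid_rank indep A"
    using basis_exists assms by blast
  have clE: "cl A \<subseteq> E" using assms by (rule cl_subset_ground)
  have rk: "matroid_rank indep (cl A) = card B"
    using matroid_rank_eqI[OF clE _ B(2)] basis_spans[OF assms B] B(1) subset_cl by blast
  have dep: "\<not> indep (insert x B)" if "x \<in> cl (cl A)" "x \<notin> B" for x
    using basis_spans[OF clE _ B(2) rk[symmetric] that] B(1) subset_cl[of A] by blast
  have "cl (cl A) \<subseteq> cl A"
  proof
    fix x assume x: "x \<in> cl (cl A)"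
    then have "x \<in> E" using cl_subset_ground[OF clE] by blast
    then show "x \<in> cl A" using dep[OF x] B(1,2) unfolding cl_def by blast
  qed
  then show ?thesis using subset_cl by blast
qed

text \<open>The set \<open>D\<close> is the fundamental circuit of \<open>e\<close> in
  \<open>I\<close> without \<open>e\<close>. If \<open>insert e D\<close> were independent,
  extending it to a basis of \<open>insert e I\<close> would omit exactly one \<open>f\<close>; that
  \<open>f\<close> is exchangeable, hence in \<open>D\<close>, a contradiction.\<close>

lemma exchangeable_spans:
  assumes "indep I" "\<not> indep (insert e I)" "e \<in> E"
  shows "e \<in> cl {f\<in>I. indep (insert e (I - {f}))}"
proof -
  define D where "D = {f\<in>I. indep (insert e (I - {f}))}"
  have DI: "indep D" "D \<subseteq> I" unfolding D_def using assms(1) indep_subset by auto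
  have "\<not> indep (insert e D)"
  proof
    assume ind: "indep (insert e D)"
    have "insert e I \<subseteq> E" using assms(1,3) indep_subset_ground by blast
    from extend_indep[OF this ind]
    obtain J where J: "insert e D \<subseteq> J" "J \<subseteq> insert e I" "indep J"
      "card J = matroid_rank indep (insert e I)"
      using DI(2) by blast
    have "card I \<le> card J"
      using card_le_matroid_rank[OF \<open>insert e I \<subseteq> E\<close> assms(1)] J(4) by auto
    have "e \<notin> I" using assms(1,2) by (metis insert_absorb)
    have "J \<noteq> insert e I" using J(3) assms(2) by blast
    then obtain f where f: "f \<in> insert e I" "f \<notin> J" using J(2) by blast
    then have fI: "f \<in> I" "f \<noteq> e" using J(1) by auto
    have sub: "J \<subseteq> insert e (I - {f})" using J(2) f(2) by blast
    have fin: "finite I" using assms(1) finite_indep by blast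
    have "card (insert e (I - {f})) = card I"
      using fI fin \<open>e \<notin> I\<close> card.remove[OF fin fI(1)] by simp
    then have "J = insert e (I - {f})"
      using card_seteq[OF _ sub] fin \<open>card I \<le> card J\<close> by simp
    then have "f \<in> D" unfolding D_def using J(3) fI by simp
    then show False using J(1) f(2) by blast
  qed
  then show ?thesis using DI assms(3) unfolding D_def[symmetric] cl_def by blast
qed

section \<open>Partial colourings and exchange chains\<close>

definition partial_colouring :: "nat \<Rightarrow> ('a \<Rightarrow> nat) \<Rightarrow> bool" where
  "partial_colouring d g \<longleftrightarrow>
     (\<forall>x\<in>E. g x \<le> d) \<and> (\<forall>i<d. indep {x\<in>E. g x = i})"

text \<open>A pair \<open>(g, e)\<close> is a partial colouring with colours \<open>0, \<dots>, d - 1\<close> together with an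
  element \<open>e\<close> that \<open>g\<close> leaves uncoloured, which is encoded by the value \<open>d\<close>.\<close>

inductive chain :: "nat \<Rightarrow> ('a \<Rightarrow> nat) \<Rightarrow> 'a \<Rightarrow> ('a \<Rightarrow> nat) \<Rightarrow> 'a \<Rightarrow> bool"
  for d g0 e0 where
  base: "chain d g0 e0 g0 e0"
| step: "chain d g0 e0 g e \<Longrightarrow> f \<in> E \<Longrightarrow> g f < d \<Longrightarrow>
    indep (insert e ({x\<in>E. g x = g f} - {f})) \<Longrightarrow> chain d g0 e0 (g(e := g f, f := d)) f"

text \<open>In a step \<open>e\<close> takes over the colour of \<open>f\<close>, and
  \<open>f\<close> becomes uncoloured in its place. Only one colour class changes, and its
  independence is the premise of the step. The unchanged count lets minimality of the initial
  colouring be used at the end of any chain.\<close>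

lemma chain_invariant:
  assumes "chain d g0 e0 g e" "partial_colouring d g0" "e0 \<in> E" "g0 e0 = d"
  shows "partial_colouring d g \<and> e \<in> E \<and> g e = d \<and>
    card {x\<in>E. g x = d} = card {x\<in>E. g0 x = d}"
  using assms
proof (induction rule: chain.induct)
  case base
  then show ?case by simp
next
  case (step g e f)
  then have IH: "partial_colouring d g" "e \<in> E" "g e = d"
    "card {x\<in>E. g x = d} = card {x\<in>E. g0 x = d}" by auto
  let ?g = "g(e := g f, f := d)"
  have ne: "e \<noteq> f" using IH(3) step.hyps by auto
  have "partial_colouring d ?g"
    unfolding partial_colouring_def
  proof (intro conjI ballI allI impI)
    show "?g x \<le> d" if "x \<in> E" for x
      using that IH(1) step.hyps unfolding partial_colouring_def by auto
    fix i assume i: "i < d"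
    show "indep {x\<in>E. ?g x = i}"
    proof (cases "i = g f")
      case True
      then have "{x\<in>E. ?g x = i} = insert e ({x\<in>E. g x = g f} - {f})"
        using i IH(2) ne by auto
      then show ?thesis using step.hyps by simp
    next
      case False
      then have "{x\<in>E. ?g x = i} = {x\<in>E. g x = i}"
        using i IH(3) by auto
      then show ?thesis using IH(1) i unfolding partial_colouring_def by simp
    qed
  qed
  moreover have "card {x\<in>E. ?g x = d} = card {x\<in>E. g x = d}"
  proof -
    have "{x\<in>E. ?g x = d} = insert f ({x\<in>E. g x = d} - {e})"
    using step.hyps ne by auto
    then show ?thesis
      using IH(2,3) step.hyps finite_ground card.remove[of "{x\<in>E. g x = d}" e] by simp
  qed
  ultimately show ?case using step.hyps IH(4) by (metis fun_upd_same)
qed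

text \<open>In an uncolourable matroid, the set \<open>S\<close> of elements that some exchange chain frees is
  spanned by each of the \<open>d\<close> initial colour classes restricted to it, so it has more than
  \<open>d\<close> times its rank elements.\<close>

theorem covering_by_indep_sets:
  assumes bound: "\<And>A. A \<subseteq> E \<Longrightarrow> card A \<le> d * matroid_rank indep A"
  shows "\<exists>\<C>. finite \<C> \<and> card \<C> \<le> d \<and> (\<forall>X\<in>\<C>. indep X) \<and> \<Union>\<C> = E"
proof -
  have "partial_colouring d (\<lambda>_. d)"
    unfolding partial_colouring_def by (simp add: indep_empty)
  then obtain g0 where g0: "partial_colouring d g0"
    "\<And>g. partial_colouring d g \<Longrightarrow> card {x\<in>E. g0 x = d} \<le> card {x\<in>E. g x = d}"
    using ex_has_least_nat[of "partial_colouring d" _ "\<lambda>g. card {x\<in>E. g x = d}"] by blast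
  have "{x\<in>E. g0 x = d} = {}"
  proof (rule ccontr)
    assume "{x\<in>E. g0 x = d} \<noteq> {}"
    then obtain e0 where e0: "e0 \<in> E" "g0 e0 = d" by blast
    define S where "S = {e. \<exists>g. chain d g0 e0 g e}"
    define J where "J g i = {x\<in>S. g x = i}" for g :: "'a \<Rightarrow> nat" and i
    note inv = chain_invariant[OF _ g0(1) e0]
    have SE: "S \<subseteq> E" unfolding S_def using inv by blast
    have JS: "J g i \<subseteq> S" for g i unfolding J_def by blast
    \<comment> \<open>Otherwise \<open>e\<close> could receive colour \<open>i\<close>, leaving
      fewer uncoloured elements than the minimal \<open>g0\<close>.\<close>
    have dep: "\<not> indep (insert e {x\<in>E. g x = i})" if ch: "chain d g0 e0 g e" and i: "i < d" for g e i
    proof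
      assume ind: "indep (insert e {x\<in>E. g x = i})"
      have g: "partial_colouring d g" "e \<in> E" "g e = d"
        "card {x\<in>E. g x = d} = card {x\<in>E. g0 x = d}" using inv[OF ch] by auto
      have "{x\<in>E. (g(e := i)) x = i} = insert e {x\<in>E. g x = i}" using g(2) by auto
      moreover have "{x\<in>E. (g(e := i)) x = j} = {x\<in>E. g x = j}" if "j < d" "j \<noteq> i" for j
        using g(3) that by auto
      moreover have "\<forall>x\<in>E. (g(e := i)) x \<le> d"
        using g(1) i unfolding partial_colouring_def by simp
      moreover have "indep {x\<in>E. g x = j}" if "j < d" for j
        using g(1) that unfolding partial_colouring_def by blast
      ultimately have "partial_colouring d (g(e := i))"
        using ind unfolding partial_colouring_def by metis
      then have "card {x\<in>E. g0 x = d} \<le> card {x\<in>E. (g(e := i)) x = d}" by (rule g0(2))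
      moreover have "{x\<in>E. (g(e := i)) x = d} \<subset> {x\<in>E. g x = d}" using g(2,3) i by auto
      then have "card {x\<in>E. (g(e := i)) x = d} < card {x\<in>E. g x = d}"
        using finite_ground by (intro psubset_card_mono) auto
      ultimately show False using g(4) by simp
    qed
    \<comment> \<open>Every \<open>f\<close> that \<open>e\<close> can replace in class
      \<open>i\<close> is freed by the chain prolonged by one step, so it lies in \<open>S\<close>;
      the exchangeable elements already span \<open>e\<close>.\<close>
    have span: "e \<in> cl (J g i)" if ch: "chain d g0 e0 g e" and i: "i < d" for g e i
    proof -
      have g: "partial_colouring d g" "e \<in> E" using inv[OF ch] by auto
      have "e \<in> cl {f\<in>{x\<in>E. g x = i}. indep (insert e ({x\<in>E. g x = i} - {f}))}"
        using exchangeable_spans[OF _ dep[OF ch i] g(2)] g(1) i unfolding partial_colouring_def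
        by blast
      moreover have "{f\<in>{x\<in>E. g x = i}. indep (insert e ({x\<in>E. g x = i} - {f}))} \<subseteq> J g i"
        using chain.step[OF ch] i unfolding J_def S_def by blast
      ultimately show ?thesis using cl_mono by blast
    qed
    \<comment> \<open>Spanning is carried back to \<open>g0\<close>: the only element that a step
      adds to a class is \<open>e\<close>, which the old class restricted to \<open>S\<close>
      already spans.\<close>
    have mono: "cl (J g i) \<subseteq> cl (J g0 i)" if ch: "chain d g0 e0 g e" and i: "i < d" for g e i
      using ch i
    proof (induction rule: chain.induct)
      case base
      then show ?case by blast
    next
      case (step g e f)
      let ?g = "g(e := g f, f := d)"
      have "e \<in> cl (J g i)" using span step by blast
      then have "J ?g i \<subseteq> cl (J g i)"
        using step.prems subset_cl[of "J g i"] unfolding J_def by auto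
      then have "cl (J ?g i) \<subseteq> cl (J g i)"
        using cl_mono cl_idem[of "J g i"] JS[of g i] SE by blast
      then show ?case using step by blast
    qed
    have indJ: "indep (J g0 i)" if "i < d" for i
      using g0(1) that indep_subset[of "{x\<in>E. g0 x = i}" "J g0 i"] SE
      unfolding partial_colouring_def J_def by blast
    have rk: "card (J g0 i) = matroid_rank indep S" if i: "i < d" for i
    proof (rule matroid_rank_eqI[symmetric, OF SE JS indJ[OF i]])
      fix x assume x: "x \<in> S - J g0 i"
      then have xcl: "x \<in> cl (J g0 i)" using span mono i unfolding S_def by blast
      have JE: "J g0 i \<subseteq> E" using JS SE by blast
      have "card (J g0 i) = matroid_rank indep (J g0 i)"
        using matroid_rank_eqI[OF JE _ indJ[OF i]] by auto
      then show "\<not> indep (insert x (J g0 i))"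
        using basis_spans[OF JE _ indJ[OF i] _ xcl] x by blast
    qed
    have fin: "finite S" using SE finite_ground finite_subset by blast
    then have finJ: "finite (J g0 i)" for i using JS finite_subset by blast
    have "e0 \<in> S" unfolding S_def using chain.base by blast
    have "d * matroid_rank indep S = (\<Sum>i<d. card (J g0 i))" using rk by simp
    also have "\<dots> = card (\<Union>i<d. J g0 i)"
      by (subst card_UN_disjoint) (use finJ in \<open>auto simp: J_def\<close>)
    also have "\<dots> < card S"
    proof (rule psubset_card_mono[OF fin])
      have "e0 \<notin> (\<Union>i<d. J g0 i)" using e0 unfolding J_def by auto
      then show "(\<Union>i<d. J g0 i) \<subset> S" using JS \<open>e0 \<in> S\<close> by blast
    qed
    finally show False using bound[OF SE] by simp
  qed
  then have lt: "g0 x < d" if "x \<in> E" for x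
    using that g0(1) unfolding partial_colouring_def by force
  let ?C = "(\<lambda>i. {x\<in>E. g0 x = i}) ` {..<d}"
  have "card ?C \<le> d" using card_image_le[of "{..<d}"] by force
  moreover have "\<forall>X\<in>?C. indep X" using g0(1) unfolding partial_colouring_def by blast
  moreover have "\<Union>?C = E" using lt by blast
  ultimately show ?thesis by (meson finite_imageI finite_lessThan)
qed

end

section \<open>Vector matroids over a finite field\<close>

lemma (in ring) finsum_in_subring:
  assumes "subring K R" "finite X" "f \<in> X \<rightarrow> K"
  shows "finsum R f X \<in> K"
  using assms(2,3)
proof (induction X rule: finite_induct)
  case empty
  then show ?case using subringE(2)[OF assms(1)] by simp
next
  case (insert x X)
  then have "f \<in> X \<rightarrow> carrier R" "f x \<in> carrier R"
    using subringE(1)[OF assms(1)] by auto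
  then have "finsum R f (insert x X) = f x \<oplus> finsum R f X"
    using insert by (intro finsum_insert) auto
  then show ?case
    using insert subringE(7)[OF assms(1)] by auto
qed

lemma (in abelian_monoid) finsum_swap:
  assumes "finite X" "finite Y" "\<And>x y. x \<in> X \<Longrightarrow> y \<in> Y \<Longrightarrow> f x y \<in> carrier G"
  shows "(\<Oplus>x\<in>X. \<Oplus>y\<in>Y. f x y) = (\<Oplus>y\<in>Y. \<Oplus>x\<in>X. f x y)"
  using assms(1,3)
proof (induction X rule: finite_induct)
  case empty
  then show ?case by simp
next
  case (insert x X)
  have "(\<Oplus>x\<in>insert x X. \<Oplus>y\<in>Y. f x y) = (\<Oplus>y\<in>Y. f x y) \<oplus> (\<Oplus>y\<in>Y. \<Oplus>x\<in>X. f x y)"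
    using insert by (subst finsum_insert) (auto intro!: finsum_closed)
  also have "\<dots> = (\<Oplus>y\<in>Y. f x y \<oplus> (\<Oplus>x\<in>X. f x y))"
    using insert by (subst finsum_addf) (auto intro!: finsum_closed)
  also have "\<dots> = (\<Oplus>y\<in>Y. \<Oplus>x\<in>insert x X. f x y)"
    using insert by (intro finsum_cong') (auto intro!: finsum_closed)
  finally show ?case .
qed

section \<open>Linear functionals on the columns of a matrix\<close>

locale vector_family = field F for F :: "('f, 'm) ring_scheme" (structure) +
  fixes m :: nat and A :: "nat \<Rightarrow> 'b \<Rightarrow> 'f"
  assumes entries: "i < m \<Longrightarrow> A i e \<in> carrier F"
    and finite_carrier: "finite (carrier F)"
begin

text \<open>The functional with coefficient vector \<phi>, evaluated at column \<open>e\<close>. The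
  locale fixes no ground set, so one family of columns serves all point sets that are compared
  later.\<close>

definition ev :: "(nat \<Rightarrow> 'f) \<Rightarrow> 'b \<Rightarrow> 'f" where
  "ev \<phi> e = (\<Oplus>i\<in>{..<m}. \<phi> i \<otimes> A i e)"

lemma ev_closed [simp]: "\<phi> \<in> {..<m} \<rightarrow> carrier F \<Longrightarrow> ev \<phi> e \<in> carrier F"
  unfolding ev_def using entries by (auto intro!: finsum_closed)

lemma ev_cong:
  assumes "\<And>i. i < m \<Longrightarrow> \<phi> i = \<psi> i" "\<psi> \<in> {..<m} \<rightarrow> carrier F"
  shows "ev \<phi> e = ev \<psi> e"
  unfolding ev_def using assms entries by (intro finsum_cong') auto

lemma ev_add:
  assumes "\<phi> \<in> {..<m} \<rightarrow> carrier F" "\<psi> \<in> {..<m} \<rightarrow> carrier F"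
  shows "ev (\<lambda>i. \<phi> i \<oplus> \<psi> i) e = ev \<phi> e \<oplus> ev \<psi> e"
proof -
  have "ev (\<lambda>i. \<phi> i \<oplus> \<psi> i) e = (\<Oplus>i\<in>{..<m}. \<phi> i \<otimes> A i e \<oplus> \<psi> i \<otimes> A i e)"
    unfolding ev_def using assms entries by (intro finsum_cong') (auto simp: l_distr Pi_iff)
  also have "\<dots> = ev \<phi> e \<oplus> ev \<psi> e"
    unfolding ev_def using assms entries by (subst finsum_addf) auto
  finally show ?thesis .
qed

lemma ev_smult:
  assumes "\<phi> \<in> {..<m} \<rightarrow> carrier F" "c \<in> carrier F"
  shows "ev (\<lambda>i. c \<otimes> \<phi> i) e = c \<otimes> ev \<phi> e"
proof -
  have "ev (\<lambda>i. c \<otimes> \<phi> i) e = (\<Oplus>i\<in>{..<m}. c \<otimes> (\<phi> i \<otimes> A i e))"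
    unfolding ev_def using assms entries by (intro finsum_cong') (auto simp: m_assoc Pi_iff)
  also have "\<dots> = c \<otimes> ev \<phi> e"
    unfolding ev_def using assms entries by (subst finsum_rdistr) auto
  finally show ?thesis .
qed

lemma ev_minus:
  assumes "\<phi> \<in> {..<m} \<rightarrow> carrier F" "\<psi> \<in> {..<m} \<rightarrow> carrier F"
  shows "ev (\<lambda>i. \<phi> i \<ominus> \<psi> i) e = ev \<phi> e \<ominus> ev \<psi> e"
proof -
  have "ev (\<lambda>i. \<phi> i \<ominus> \<psi> i) e = ev (\<lambda>i. \<phi> i \<oplus> \<ominus> \<one> \<otimes> \<psi> i) e"
    using assms by (intro ev_cong) (auto simp: a_minus_def l_minus Pi_iff)
  also have "\<dots> = ev \<phi> e \<oplus> ev (\<lambda>i. \<ominus> \<one> \<otimes> \<psi> i) e"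
    using assms by (intro ev_add) auto
  also have "\<dots> = ev \<phi> e \<ominus> ev \<psi> e"
    using assms by (subst ev_smult) (auto simp: a_minus_def l_minus)
  finally show ?thesis .
qed

lemma ev_finsum:
  assumes "finite X" "\<And>x. x \<in> X \<Longrightarrow> \<Phi> x \<in> {..<m} \<rightarrow> carrier F"
  shows "ev (\<lambda>i. \<Oplus>x\<in>X. \<Phi> x i) e = (\<Oplus>x\<in>X. ev (\<Phi> x) e)"
proof -
  have "ev (\<lambda>i. \<Oplus>x\<in>X. \<Phi> x i) e = (\<Oplus>i\<in>{..<m}. \<Oplus>x\<in>X. \<Phi> x i \<otimes> A i e)"
    unfolding ev_def
  proof (rule finsum_cong', goal_cases)
    case (3 i)
    then show ?case using assms entries by (intro finsum_ldistr) (auto simp: Pi_iff)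
  qed (use assms entries in \<open>auto simp: Pi_iff intro!: finsum_closed\<close>)
  also have "\<dots> = (\<Oplus>x\<in>X. \<Oplus>i\<in>{..<m}. \<Phi> x i \<otimes> A i e)"
    using assms entries by (intro finsum_swap) (auto simp: Pi_iff)
  finally show ?thesis unfolding ev_def .
qed

lemma ev_unit:
  assumes "i < m"
  shows "ev (\<lambda>j. if j = i then \<one> else \<zero>) e = A i e"
proof -
  have "ev (\<lambda>j. if j = i then \<one> else \<zero>) e = (\<Oplus>j\<in>{..<m}. if i = j then A j e else \<zero>)"
    unfolding ev_def using entries by (intro finsum_cong') auto
  also have "\<dots> = A i e"
    using assms entries by (intro finsum_singleton) auto
  finally show ?thesis .
qed

lemma ev_in_subring:
  assumes "subring K F" "\<phi> \<in> {..<m} \<rightarrow> K" "\<And>i. i < m \<Longrightarrow> A i e \<in> K"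
  shows "ev \<phi> e \<in> K"
  unfolding ev_def using assms subringE(6)[OF assms(1)]
  by (intro finsum_in_subring[OF assms(1)]) auto

text \<open>A dual family with coefficients in \<open>K\<close> serves as a certificate of
  independence that remains valid over every larger coefficient set.\<close>

definition dual :: "'f set \<Rightarrow> ('b \<Rightarrow> nat \<Rightarrow> 'f) \<Rightarrow> 'b set \<Rightarrow> bool" where
  "dual K \<Phi> X \<longleftrightarrow>
     (\<forall>x\<in>X. \<Phi> x \<in> {..<m} \<rightarrow> K \<and> (\<forall>y\<in>X. ev (\<Phi> x) y = (if x = y then \<one> else \<zero>)))"

lemma dual_subset: "dual K \<Phi> X \<Longrightarrow> Y \<subseteq> X \<Longrightarrow> dual K \<Phi> Y"
  unfolding dual_def by blast

lemma dual_mono: "dual K \<Phi> X \<Longrightarrow> K \<subseteq> L \<Longrightarrow> dual L \<Phi> X"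
  unfolding dual_def by blast

text \<open>One elimination step: \<psi> is scaled to \<theta> with value one at \<open>v\<close>,
  and each old functional is corrected by a multiple of \<theta> so as to vanish at
  \<open>v\<close>. Its values on \<open>X\<close> survive because \<theta> is zero there.\<close>

lemma dual_insert:
  assumes K: "subfield K F" and v: "v \<notin> X"
    and \<Phi>: "dual K \<Phi> X"
    and ent: "\<And>i. i < m \<Longrightarrow> A i v \<in> K"
    and \<psi>: "\<psi> \<in> {..<m} \<rightarrow> K" "\<And>x. x \<in> X \<Longrightarrow> ev \<psi> x = \<zero>" "ev \<psi> v \<noteq> \<zero>"
  shows "\<exists>\<Phi>'. dual K \<Phi>' (insert v X)"
proof -
  note sr = subfieldE(1)[OF K]
  note Kc = subfieldE(3)[OF K]
  have evK: "ev \<phi> v \<in> K" if "\<phi> \<in> {..<m} \<rightarrow> K" for \<phi>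
    using ev_in_subring[OF sr that] ent by blast
  define c where "c = inv (ev \<psi> v)"
  have c: "c \<in> K" "c \<otimes> ev \<psi> v = \<one>"
    using subfield_m_inv[OF K] evK[OF \<psi>(1)] \<psi>(3) unfolding c_def by auto
  define \<theta> where "\<theta> i = c \<otimes> \<psi> i" for i
  have \<theta>K: "\<theta> \<in> {..<m} \<rightarrow> K"
    unfolding \<theta>_def using \<psi>(1) c(1) subringE(6)[OF sr] by auto
  have \<psi>c: "\<psi> \<in> {..<m} \<rightarrow> carrier F" and \<theta>c: "\<theta> \<in> {..<m} \<rightarrow> carrier F"
    using \<psi>(1) \<theta>K Kc by auto
  have cc: "c \<in> carrier F" using c(1) Kc by blast
  have \<theta>v: "ev \<theta> v = \<one>" unfolding \<theta>_def using ev_smult[OF \<psi>c cc] c(2) by simp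
  have \<theta>x: "ev \<theta> x = \<zero>" if "x \<in> X" for x
    unfolding \<theta>_def using ev_smult[OF \<psi>c cc] \<psi>(2)[OF that] cc by simp
  define \<Phi>' where "\<Phi>' x = (if x = v then \<theta> else (\<lambda>i. \<Phi> x i \<ominus> ev (\<Phi> x) v \<otimes> \<theta> i))" for x
  have \<Phi>K: "\<Phi> x \<in> {..<m} \<rightarrow> K" if "x \<in> X" for x
    using \<Phi> that unfolding dual_def by blast
  have \<Phi>c: "\<Phi> x \<in> {..<m} \<rightarrow> carrier F" if "x \<in> X" for x
    using \<Phi>K[OF that] Kc by auto
  have in_K: "\<Phi>' x \<in> {..<m} \<rightarrow> K" if "x \<in> insert v X" for x
    using that \<theta>K \<Phi>K evK[OF \<Phi>K] subringE(5,6,7)[OF sr]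
    unfolding \<Phi>'_def a_minus_def by (auto simp: Pi_iff)
  have ev': "ev (\<Phi>' x) y = ev (\<Phi> x) y \<ominus> ev (\<Phi> x) v \<otimes> ev \<theta> y" if "x \<in> X" for x y
  proof -
    have "x \<noteq> v" using v that by auto
    have d: "ev (\<Phi> x) v \<in> carrier F" using \<Phi>c[OF that] by simp
    have "ev (\<Phi>' x) y = ev (\<Phi> x) y \<ominus> ev (\<lambda>i. ev (\<Phi> x) v \<otimes> \<theta> i) y"
      using \<open>x \<noteq> v\<close> \<Phi>c[OF that] \<theta>c d unfolding \<Phi>'_def by (simp add: ev_minus Pi_iff)
    then show ?thesis using ev_smult[OF \<theta>c d] by simp
  qed
  have "dual K \<Phi>' (insert v X)"
    unfolding dual_def
  proof (intro ballI conjI)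
    fix x y assume x: "x \<in> insert v X" and y: "y \<in> insert v X"
    show "ev (\<Phi>' x) y = (if x = y then \<one> else \<zero>)"
    proof (cases "x = v")
      case True
      then show ?thesis using y v \<theta>v \<theta>x unfolding \<Phi>'_def by auto
    next
      case False
      then have x': "x \<in> X" using x by simp
      show ?thesis
      proof (cases "y = v")
        case True
        then show ?thesis using ev'[OF x'] False \<theta>v \<Phi>c[OF x'] by simp
      next
        case False
        then have y': "y \<in> X" using y by simp
        then show ?thesis using ev'[OF x'] \<theta>x[OF y'] \<Phi> \<Phi>c[OF x'] x'
          unfolding dual_def by (auto simp: a_minus_def)
      qed
    qed
  qed (use in_K in blast)
  then show ?thesis by blast
qed

text \<open>If the \<open>i\<close>-th row violates the expansion of \<open>v\<close> in \<open>X\<close>, then the \<open>i\<close>-th coordinate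
  functional minus its expansion in the dual family kills \<open>X\<close> but not \<open>v\<close>.\<close>

lemma dual_extend_or_expand:
  assumes K: "subfield K F" and X: "finite X" and v: "v \<notin> X" and \<Phi>: "dual K \<Phi> X"
    and ent: "\<And>i x. i < m \<Longrightarrow> x \<in> insert v X \<Longrightarrow> A i x \<in> K"
    and max: "\<nexists>\<Phi>'. dual K \<Phi>' (insert v X)"
    and i: "i < m"
  shows "A i v = (\<Oplus>x\<in>X. ev (\<Phi> x) v \<otimes> A i x)"
proof (rule ccontr)
  assume neq: "A i v \<noteq> (\<Oplus>x\<in>X. ev (\<Phi> x) v \<otimes> A i x)"
  note sr = subfieldE(1)[OF K]
  note Kc = subfieldE(3)[OF K]
  have \<Phi>K: "\<Phi> x \<in> {..<m} \<rightarrow> K" if "x \<in> X" for x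
    using \<Phi> that unfolding dual_def by blast
  have \<Phi>c: "\<Phi> x \<in> {..<m} \<rightarrow> carrier F" if "x \<in> X" for x
    using \<Phi>K[OF that] Kc by auto
  define u where "u j = (if j = i then \<one> else \<zero>)" for j :: nat
  define w where "w j = (\<Oplus>x\<in>X. A i x \<otimes> \<Phi> x j)" for j
  have uK: "u \<in> {..<m} \<rightarrow> K" unfolding u_def using subringE(2,3)[OF sr] by auto
  have wK: "w \<in> {..<m} \<rightarrow> K"
    unfolding w_def using ent i \<Phi>K subringE(6)[OF sr]
    by (intro Pi_I finsum_in_subring[OF sr X]) (auto simp: Pi_iff)
  have uc: "u \<in> {..<m} \<rightarrow> carrier F" and wc: "w \<in> {..<m} \<rightarrow> carrier F"
    using uK wK Kc by auto
  have w: "ev w y = (\<Oplus>x\<in>X. ev (\<Phi> x) y \<otimes> A i x)" for y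
  proof -
    have "ev w y = (\<Oplus>x\<in>X. ev (\<lambda>j. A i x \<otimes> \<Phi> x j) y)"
      unfolding w_def using X \<Phi>c entries[OF i] by (intro ev_finsum) (auto simp: Pi_iff)
    also have "\<dots> = (\<Oplus>x\<in>X. ev (\<Phi> x) y \<otimes> A i x)"
      using \<Phi>c entries[OF i] by (intro finsum_cong') (auto simp: ev_smult m_comm)
    finally show ?thesis .
  qed
  have u: "ev u y = A i y" for y unfolding u_def by (rule ev_unit[OF i])
  have "ev (\<lambda>j. u j \<ominus> w j) y = \<zero>" if "y \<in> X" for y
  proof -
    have "ev w y = (\<Oplus>x\<in>X. if y = x then A i x else \<zero>)"
      unfolding w using \<Phi> that entries[OF i] unfolding dual_def
      by (intro finsum_cong') auto
    also have "\<dots> = A i y" using X that entries[OF i] by (intro finsum_singleton) auto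
    finally show ?thesis
      using ev_minus[OF uc wc, of y] u entries[OF i] by simp
  qed
  moreover have "ev (\<lambda>j. u j \<ominus> w j) v \<noteq> \<zero>"
    using neq ev_minus[OF uc wc, of v] u w entries[OF i] ev_closed[OF wc] by simp
  moreover have "(\<lambda>j. u j \<ominus> w j) \<in> {..<m} \<rightarrow> K"
    using uK wK subringE(5,7)[OF sr] unfolding a_minus_def by (simp add: Pi_iff)
  ultimately show False
    using dual_insert[OF K v \<Phi>] ent max by blast
qed

lemma ev_expand:
  assumes X: "finite X" and c: "c \<in> X \<rightarrow> carrier F" and \<phi>: "\<phi> \<in> {..<m} \<rightarrow> carrier F"
  shows "(\<Oplus>i\<in>{..<m}. \<phi> i \<otimes> (\<Oplus>x\<in>X. c x \<otimes> A i x)) = (\<Oplus>x\<in>X. c x \<otimes> ev \<phi> x)"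
proof -
  have "(\<Oplus>i\<in>{..<m}. \<phi> i \<otimes> (\<Oplus>x\<in>X. c x \<otimes> A i x)) = (\<Oplus>i\<in>{..<m}. \<Oplus>x\<in>X. c x \<otimes> (\<phi> i \<otimes> A i x))"
  proof (rule finsum_cong', goal_cases)
    case (3 i)
    have "\<phi> i \<otimes> (\<Oplus>x\<in>X. c x \<otimes> A i x) = (\<Oplus>x\<in>X. \<phi> i \<otimes> (c x \<otimes> A i x))"
      using 3 assms entries by (intro finsum_rdistr) (auto simp: Pi_iff)
    also have "\<dots> = (\<Oplus>x\<in>X. c x \<otimes> (\<phi> i \<otimes> A i x))"
      using 3 assms entries by (intro finsum_cong') (auto simp: Pi_iff m_lcomm)
    finally show ?case .
  qed (use assms entries in \<open>auto simp: Pi_iff intro!: finsum_closed\<close>)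
  also have "\<dots> = (\<Oplus>x\<in>X. \<Oplus>i\<in>{..<m}. c x \<otimes> (\<phi> i \<otimes> A i x))"
    using assms entries by (intro finsum_swap) (auto simp: Pi_iff)
  also have "\<dots> = (\<Oplus>x\<in>X. c x \<otimes> ev \<phi> x)"
  proof (rule finsum_cong', goal_cases)
    case (3 x)
    then show ?case unfolding ev_def using assms entries
      by (intro finsum_rdistr[symmetric]) (auto simp: Pi_iff)
  qed (use assms in \<open>auto simp: Pi_iff\<close>)
  finally show ?thesis .
qed

text \<open>A dual functional applied to a vanishing relation isolates one coefficient. Conversely,
  if the dual family cannot be extended to \<open>v\<close>, the expansion of \<open>v\<close> holds
  in every row and yields a relation with coefficient \<open>\<ominus> \<one>\<close> at
  \<open>v\<close>.\<close>

lemma columns_independent_iff_dual: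
  assumes "finite X"
  shows "columns_independent F m A X \<longleftrightarrow> (\<exists>\<Phi>. dual (carrier F) \<Phi> X)"
proof
  assume "\<exists>\<Phi>. dual (carrier F) \<Phi> X"
  then obtain \<Phi> where \<Phi>: "dual (carrier F) \<Phi> X" by blast
  show "columns_independent F m A X"
    unfolding columns_independent_def
  proof (intro ballI impI)
    fix c x assume c: "c \<in> X \<rightarrow> carrier F" and x: "x \<in> X"
      and zero: "\<forall>i<m. (\<Oplus>e\<in>X. c e \<otimes> A i e) = \<zero>"
    have \<phi>: "\<Phi> x \<in> {..<m} \<rightarrow> carrier F" using \<Phi> x unfolding dual_def by blast
    have "\<zero> = (\<Oplus>i\<in>{..<m}. \<Phi> x i \<otimes> (\<Oplus>e\<in>X. c e \<otimes> A i e))"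
      using zero \<phi> by (subst finsum_cong'[of _ _ "\<lambda>_. \<zero>"]) (auto simp: Pi_iff)
    also have "\<dots> = (\<Oplus>e\<in>X. c e \<otimes> ev (\<Phi> x) e)" by (rule ev_expand[OF assms c \<phi>])
    also have "\<dots> = (\<Oplus>e\<in>X. if x = e then c e else \<zero>)"
      using \<Phi> x c unfolding dual_def by (intro finsum_cong') (auto simp: Pi_iff)
    also have "\<dots> = c x" using assms x c by (intro finsum_singleton) auto
    finally show "c x = \<zero>" by simp
  qed
next
  assume "columns_independent F m A X"
  with assms show "\<exists>\<Phi>. dual (carrier F) \<Phi> X"
  proof (induction X rule: finite_induct)
    case empty
    then show ?case unfolding dual_def by simp
  next
    case (insert v X)
    note ci = insert.prems
    have "columns_independent F m A X"
      unfolding columns_independent_def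
    proof (intro ballI impI)
      fix c x assume c: "c \<in> X \<rightarrow> carrier F" and x: "x \<in> X"
        and zero: "\<forall>i<m. (\<Oplus>e\<in>X. c e \<otimes> A i e) = \<zero>"
      let ?c = "c(v := \<zero>)"
      have "(\<Oplus>e\<in>insert v X. ?c e \<otimes> A i e) = \<zero>" if "i < m" for i
      proof -
        have "(\<Oplus>e\<in>insert v X. ?c e \<otimes> A i e) = \<zero> \<otimes> A i v \<oplus> (\<Oplus>e\<in>X. ?c e \<otimes> A i e)"
          using insert.hyps c entries[OF that] by (subst finsum_insert) (auto simp: Pi_iff)
        also have "(\<Oplus>e\<in>X. ?c e \<otimes> A i e) = (\<Oplus>e\<in>X. c e \<otimes> A i e)"
          using insert.hyps c entries[OF that] by (intro finsum_cong') (auto simp: Pi_iff)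
        finally show ?thesis using zero that entries[OF that] by simp
      qed
      moreover have "?c \<in> insert v X \<rightarrow> carrier F" using c by auto
      ultimately have "?c x = \<zero>" using ci x unfolding columns_independent_def by blast
      then show "c x = \<zero>" using x insert.hyps by (auto split: if_splits)
    qed
    then obtain \<Phi> where \<Phi>: "dual (carrier F) \<Phi> X" using insert.IH by blast
    show ?case
    proof (rule ccontr)
      assume "\<nexists>\<Phi>. dual (carrier F) \<Phi> (insert v X)"
      then have ex: "A i v = (\<Oplus>x\<in>X. ev (\<Phi> x) v \<otimes> A i x)" if "i < m" for i
        using dual_extend_or_expand[OF carrier_is_subfield insert.hyps \<Phi>] entries that by blast
      have \<Phi>c: "ev (\<Phi> x) v \<in> carrier F" if "x \<in> X" for x
        using \<Phi> that unfolding dual_def by auto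
      define c where "c x = (if x = v then \<ominus> \<one> else ev (\<Phi> x) v)" for x
      have "(\<Oplus>e\<in>insert v X. c e \<otimes> A i e) = \<zero>" if "i < m" for i
      proof -
        have "(\<Oplus>e\<in>insert v X. c e \<otimes> A i e) = c v \<otimes> A i v \<oplus> (\<Oplus>e\<in>X. c e \<otimes> A i e)"
          using insert.hyps \<Phi>c entries[OF that]
          by (intro finsum_insert) (auto simp: Pi_iff c_def)
        also have "(\<Oplus>e\<in>X. c e \<otimes> A i e) = A i v"
          unfolding ex[OF that]
          using insert.hyps \<Phi>c entries[OF that] by (intro finsum_cong') (auto simp: Pi_iff c_def)
        finally show ?thesis using entries[OF that] by (simp add: c_def l_minus l_neg)
      qed
      moreover have "c \<in> insert v X \<rightarrow> carrier F" using \<Phi>c unfolding c_def by auto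
      ultimately have "c v = \<zero>" using ci unfolding columns_independent_def by blast
      then show False unfolding c_def by (metis add.inv_eq_1_iff one_closed one_not_zero)
    qed
  qed
qed

end

text \<open>Toggling one fixed element pairs the subsets with opposite signs.\<close>

lemma sum_Pow_alternating:
  assumes "finite S" "S \<noteq> {}"
  shows "(\<Sum>T\<in>Pow S. (- 1) ^ card T) = (0 :: 'a :: comm_ring_1)"
proof -
  obtain x where x: "x \<in> S" using assms by blast
  define R where "R = S - {x}"
  have R: "S = insert x R" "x \<notin> R" "finite R" unfolding R_def using x assms by auto
  have inj: "inj_on (insert x) (Pow R)"
    using R(2) by (auto simp: inj_on_def)
  have "(\<Sum>T\<in>Pow S. (- 1) ^ card T) =
      (\<Sum>T\<in>Pow R. (- 1) ^ card T) + (\<Sum>T\<in>insert x ` Pow R. (- 1 :: 'a) ^ card T)"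
    unfolding R(1) Pow_insert using R by (intro sum.union_disjoint) auto
  also have "(\<Sum>T\<in>insert x ` Pow R. (- 1 :: 'a) ^ card T) = (\<Sum>T\<in>Pow R. - ((- 1) ^ card T))"
    unfolding sum.reindex[OF inj] using R
    by (intro sum.cong) (auto simp: finite_subset card_insert_if)
  finally show ?thesis by (simp add: sum_negf)
qed

section \<open>Annihilators, rank and the characteristic polynomial\<close>

context vector_family
begin

abbreviation q :: nat where "q \<equiv> card (carrier F)"

lemma q_gt_1: "1 < q"
proof -
  have "card {\<zero>, \<one>} \<le> q" using finite_carrier by (intro card_mono) auto
  then show ?thesis by simp
qed

text \<open>Extensional coefficient functions make the annihilator finite and count every functional
  once.\<close>

definition ann :: "'b set \<Rightarrow> (nat \<Rightarrow> 'f) set" where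
  "ann X = {\<phi> \<in> {..<m} \<rightarrow>\<^sub>E carrier F. \<forall>x\<in>X. ev \<phi> x = \<zero>}"

lemma finite_ann: "finite (ann X)"
proof -
  have "finite ({..<m} \<rightarrow>\<^sub>E carrier F)" using finite_carrier by (intro finite_PiE) auto
  then show ?thesis unfolding ann_def by simp
qed

lemma ann_ne: "ann X \<noteq> {}"
proof -
  have "ev (\<lambda>i\<in>{..<m}. \<zero>) x = \<zero>" for x
    unfolding ev_def using entries by (subst finsum_cong'[of _ _ "\<lambda>_. \<zero>"]) auto
  then have "(\<lambda>i\<in>{..<m}. \<zero>) \<in> ann X" unfolding ann_def by auto
  then show ?thesis by blast
qed

text \<open>A functional in \<open>ann X\<close> corresponds to its value at \<open>v\<close>
  together with what remains after subtracting that multiple of \<psi>; the value ranges over the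
  whole field.\<close>

lemma card_ann_insert:
  assumes \<psi>: "\<psi> \<in> {..<m} \<rightarrow> carrier F" "\<And>x. x \<in> X \<Longrightarrow> ev \<psi> x = \<zero>" "ev \<psi> v = \<one>"
  shows "card (ann X) = q * card (ann (insert v X))"
proof -
  define f where "f = (\<lambda>(c, \<phi>). \<lambda>i\<in>{..<m}. \<phi> i \<oplus> c \<otimes> \<psi> i)"
  define g where "g \<phi> = (ev \<phi> v, \<lambda>i\<in>{..<m}. \<phi> i \<ominus> ev \<phi> v \<otimes> \<psi> i)" for \<phi>
  have ev_f: "ev (f (c, \<phi>)) x = ev \<phi> x \<oplus> c \<otimes> ev \<psi> x"
    if "c \<in> carrier F" "\<phi> \<in> {..<m} \<rightarrow> carrier F" for c \<phi> x
  proof -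
    have "ev (f (c, \<phi>)) x = ev (\<lambda>i. \<phi> i \<oplus> c \<otimes> \<psi> i) x"
      using that \<psi>(1) unfolding f_def by (intro ev_cong) (auto simp: Pi_iff)
    also have "\<dots> = ev \<phi> x \<oplus> ev (\<lambda>i. c \<otimes> \<psi> i) x"
      using that \<psi>(1) by (intro ev_add) (auto simp: Pi_iff)
    finally show ?thesis using ev_smult[OF \<psi>(1) that(1)] by simp
  qed
  have ev_g: "ev (snd (g \<phi>)) x = ev \<phi> x \<ominus> ev \<phi> v \<otimes> ev \<psi> x"
    if "\<phi> \<in> {..<m} \<rightarrow> carrier F" for \<phi> x
  proof -
    have "ev (snd (g \<phi>)) x = ev (\<lambda>i. \<phi> i \<ominus> ev \<phi> v \<otimes> \<psi> i) x"
      using that \<psi>(1) unfolding g_def by (simp, intro ev_cong) (auto simp: Pi_iff)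
    also have "\<dots> = ev \<phi> x \<ominus> ev (\<lambda>i. ev \<phi> v \<otimes> \<psi> i) x"
      using that \<psi>(1) by (intro ev_minus) (auto simp: Pi_iff)
    finally show ?thesis using ev_smult[OF \<psi>(1) ev_closed[OF that]] by simp
  qed
  have "bij_betw f (carrier F \<times> ann (insert v X)) (ann X)"
  proof (rule bij_betwI[where g = g])
    show "f \<in> carrier F \<times> ann (insert v X) \<rightarrow> ann X"
    proof
      fix z assume "z \<in> carrier F \<times> ann (insert v X)"
      then obtain c \<phi> where z: "z = (c, \<phi>)" "c \<in> carrier F" "\<phi> \<in> ann (insert v X)" by blast
      then have \<phi>: "\<phi> \<in> {..<m} \<rightarrow> carrier F" unfolding ann_def by auto
      have "f z \<in> {..<m} \<rightarrow>\<^sub>E carrier F" unfolding f_def z using z(2) \<phi> \<psi>(1) by auto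
      moreover have "ev (f z) x = \<zero>" if "x \<in> X" for x
        using ev_f[OF z(2) \<phi>] z \<psi>(2)[OF that] that unfolding ann_def by simp
      ultimately show "f z \<in> ann X" unfolding ann_def by simp
    qed
    show "g \<in> ann X \<rightarrow> carrier F \<times> ann (insert v X)"
    proof
      fix \<phi> assume a: "\<phi> \<in> ann X"
      then have \<phi>: "\<phi> \<in> {..<m} \<rightarrow> carrier F" unfolding ann_def by auto
      have "snd (g \<phi>) \<in> {..<m} \<rightarrow>\<^sub>E carrier F" unfolding g_def using \<phi> \<psi>(1) by (auto simp: Pi_iff)
      moreover have "ev (snd (g \<phi>)) v = \<zero>"
        using ev_g[OF \<phi>, of v] \<psi>(3) ev_closed[OF \<phi>, of v] by (simp add: a_minus_def r_neg)
      moreover have "ev (snd (g \<phi>)) x = \<zero>" if "x \<in> X" for x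
        using ev_g[OF \<phi>, of x] \<psi>(2)[OF that] ev_closed[OF \<phi>, of v] that a
        unfolding ann_def by (simp add: a_minus_def)
      ultimately show "g \<phi> \<in> carrier F \<times> ann (insert v X)"
        unfolding ann_def using \<phi> by (auto simp: g_def)
    qed
    show "g (f z) = z" if z: "z \<in> carrier F \<times> ann (insert v X)" for z
    proof -
      obtain c \<phi> where z: "z = (c, \<phi>)" "c \<in> carrier F" "\<phi> \<in> ann (insert v X)" using z by blast
      then have \<phi>: "\<phi> \<in> {..<m} \<rightarrow>\<^sub>E carrier F" "ev \<phi> v = \<zero>" unfolding ann_def by auto
      then have \<phi>': "\<phi> \<in> {..<m} \<rightarrow> carrier F" by auto
      have c: "ev (f z) v = c" using ev_f[OF z(2) \<phi>'] \<phi>(2) \<psi>(3) z by simp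
      have "snd (g (f z)) i = \<phi> i" for i
      proof (cases "i < m")
        case True
        then have "snd (g (f z)) i = \<phi> i \<oplus> c \<otimes> \<psi> i \<ominus> c \<otimes> \<psi> i"
          unfolding g_def using c by (simp add: z f_def)
        then show ?thesis
          using True \<phi>' \<psi>(1) z(2) by (simp add: a_minus_def a_assoc r_neg Pi_iff)
      next
        case False
        then show ?thesis using PiE_arb[OF \<phi>(1), of i] by (simp add: g_def)
      qed
      then have "snd (g (f z)) = \<phi>" by (rule ext)
      moreover have "fst (g (f z)) = c" using c by (simp only: g_def fst_conv)
      ultimately have "g (f z) = (c, \<phi>)" by (metis prod.collapse)
      then show ?thesis by (simp only: z(1))
    qed
    show "f (g \<phi>) = \<phi>" if a: "\<phi> \<in> ann X" for \<phi>
    proof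
      fix i
      have \<phi>: "\<phi> \<in> {..<m} \<rightarrow>\<^sub>E carrier F" using a unfolding ann_def by auto
      then have \<phi>': "\<phi> \<in> {..<m} \<rightarrow> carrier F" by auto
      show "f (g \<phi>) i = \<phi> i"
      proof (cases "i < m")
        case True
        then show ?thesis unfolding f_def g_def using \<phi>' \<psi>(1)
          by (simp add: a_minus_def a_assoc l_neg Pi_iff)
      next
        case False
        then show ?thesis using PiE_arb[OF \<phi>, of i] by (simp add: f_def g_def)
      qed
    qed
  qed
  then have "card (carrier F \<times> ann (insert v X)) = card (ann X)" by (rule bij_betw_same_card)
  then show ?thesis by (simp add: card_cartesian_product)
qed

definition ind :: "'b set \<Rightarrow> bool" where
  "ind X \<longleftrightarrow> (\<exists>\<Phi>. dual (carrier F) \<Phi> X)"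

lemma ind_subset: "ind X \<Longrightarrow> Y \<subseteq> X \<Longrightarrow> ind Y"
  unfolding ind_def using dual_subset by blast

lemma ind_empty: "ind {}"
  unfolding ind_def dual_def by simp

text \<open>Rank-nullity by counting: each further independent column divides the annihilator by
  exactly \<open>q\<close>. The product form avoids natural subtraction in the exponent.\<close>

lemma card_ann_ind:
  assumes "finite X" "ind X"
  shows "card (ann X) * q ^ card X = q ^ m"
  using assms
proof (induction X rule: finite_induct)
  case empty
  have "ann {} = {..<m} \<rightarrow>\<^sub>E carrier F" unfolding ann_def by simp
  then show ?case by (simp add: card_PiE)
next
  case (insert v X)
  obtain \<Phi> where \<Phi>: "dual (carrier F) \<Phi> (insert v X)"
    using insert.prems unfolding ind_def by blast
  have "card (ann X) = q * card (ann (insert v X))"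
  proof (rule card_ann_insert)
    show "\<Phi> v \<in> {..<m} \<rightarrow> carrier F" "ev (\<Phi> v) v = \<one>"
      using \<Phi> unfolding dual_def by auto
    show "ev (\<Phi> v) x = \<zero>" if "x \<in> X" for x
      using \<Phi> that insert.hyps unfolding dual_def by auto
  qed
  moreover have "card (ann X) * q ^ card X = q ^ m"
    using insert.IH ind_subset[OF insert.prems] by blast
  ultimately show ?case using insert.hyps by (simp add: mult_ac)
qed

lemma card_ann_pos: "0 < card (ann X)"
  using finite_ann ann_ne by (simp add: card_gt_0_iff)

lemma card_ind_le:
  assumes "finite X" "ind X"
  shows "card X \<le> m"
proof (rule ccontr)
  assume "\<not> card X \<le> m"
  then have "q ^ m < q ^ card X" using q_gt_1 by (intro power_strict_increasing) auto
  also have "\<dots> \<le> card (ann X) * q ^ card X" using card_ann_pos[of X] by simp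
  finally show False using card_ann_ind[OF assms] by simp
qed

text \<open>A functional that vanishes on \<open>X\<close> but not at \<open>v\<close> would extend
  the dual family by \<open>dual_insert\<close>.\<close>

lemma ann_kills:
  assumes "ind X" "v \<notin> X" "\<not> ind (insert v X)" "\<phi> \<in> ann X"
  shows "ev \<phi> v = \<zero>"
proof (rule ccontr)
  assume "ev \<phi> v \<noteq> \<zero>"
  moreover obtain \<Phi> where "dual (carrier F) \<Phi> X" using assms(1) unfolding ind_def by blast
  ultimately show False
    using dual_insert[OF carrier_is_subfield assms(2), of \<Phi> \<phi>] assms entries
    unfolding ind_def ann_def by auto
qed

lemma ann_antimono: "X \<subseteq> Y \<Longrightarrow> ann Y \<subseteq> ann X"
  unfolding ann_def by blast

definition ind_on :: "'b set \<Rightarrow> 'b set \<Rightarrow> bool" where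
  "ind_on E X \<longleftrightarrow> X \<subseteq> E \<and> ind X"

text \<open>Augmentation is a size comparison: if no element of \<open>Y\<close> extends
  \<open>X\<close>, every functional vanishing on \<open>X\<close> vanishes on \<open>Y\<close>,
  although the larger independent set must have the smaller annihilator.\<close>

lemma matroid_ind_on:
  assumes "finite E"
  shows "matroid E (ind_on E)"
proof
  fix X Y
  assume X: "ind_on E X" and Y: "ind_on E Y" and less: "card X < card Y"
  have fin: "finite X" "finite Y" using X Y assms finite_subset unfolding ind_on_def by auto
  show "\<exists>y\<in>Y - X. ind_on E (insert y X)"
  proof (rule ccontr)
    assume no: "\<not> ?thesis"
    have "ev \<phi> y = \<zero>" if "\<phi> \<in> ann X" "y \<in> Y" for \<phi> y
    proof (cases "y \<in> X")
      case True
      then show ?thesis using that unfolding ann_def by blast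
    next
      case False
      then show ?thesis using ann_kills[of X y \<phi>] no that X Y unfolding ind_on_def by blast
    qed
    then have "ann X \<subseteq> ann Y" unfolding ann_def by blast
    then have le: "card (ann X) \<le> card (ann Y)" using finite_ann by (intro card_mono)
    have "card (ann X) * q ^ card X < card (ann X) * q ^ card Y"
      using card_ann_pos[of X] power_strict_increasing[OF less q_gt_1] by simp
    also have "\<dots> \<le> card (ann Y) * q ^ card Y" using le by simp
    finally show False
      using card_ann_ind[OF fin(1)] card_ann_ind[OF fin(2)] X Y unfolding ind_on_def by simp
  qed
qed (use assms in \<open>auto simp: ind_on_def ind_empty intro: ind_subset\<close>)

lemma representable_ind_on:
  assumes "finite E"
  shows "matroid_representable F E (ind_on E)"
  unfolding matroid_representable_def ind_on_def ind_def
  using entries columns_independent_iff_dual finite_subset[OF _ assms] by blast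

text \<open>A basis of \<open>X\<close> has the same annihilator as \<open>X\<close>.\<close>

lemma card_ann_rank:
  assumes "finite E" "X \<subseteq> E"
  shows "card (ann X) * q ^ matroid_rank (ind_on E) X = q ^ m"
proof -
  interpret matroid E "ind_on E" by (rule matroid_ind_on[OF assms(1)])
  obtain B where B: "B \<subseteq> X" "ind_on E B" "card B = matroid_rank (ind_on E) X"
    using basis_exists assms(2) by blast
  have "ev \<phi> x = \<zero>" if "\<phi> \<in> ann B" "x \<in> X" for \<phi> x
  proof (cases "x \<in> B")
    case True
    then show ?thesis using that unfolding ann_def by blast
  next
    case False
    have "\<not> ind_on E (insert x B)"
      using basis_spans[OF assms(2) B _ False] subset_cl that by blast
    then show ?thesis
      using ann_kills[OF _ False _ that(1)] B(2) assms(2) that(2) unfolding ind_on_def by blast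
  qed
  then have "ann X = ann B" using ann_antimono[OF B(1)] unfolding ann_def by blast
  moreover have "finite B" using finite_indep B(2) by blast
  ultimately show ?thesis using card_ann_ind[of B] B unfolding ind_on_def by simp
qed

text \<open>The critical theorem of Crapo and Rota, in the direction needed here: up to a power of
  \<open>q\<close>, the value of the characteristic polynomial at \<open>q\<close> is by inclusion-exclusion the number
  of linear functionals without a zero on \<open>E\<close>.\<close>

lemma char_poly_zero:
  assumes E: "finite E" and blocked: "\<And>\<phi>. \<phi> \<in> {..<m} \<rightarrow>\<^sub>E carrier F \<Longrightarrow> \<exists>e\<in>E. ev \<phi> e = \<zero>"
  shows "poly (char_poly_matroid E (ind_on E)) (int q) = 0"
proof -
  let ?rk = "matroid_rank (ind_on E)"
  interpret matroid E "ind_on E" by (rule matroid_ind_on[OF E])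
  have rk_le: "?rk X \<le> ?rk E" if X: "X \<subseteq> E" for X
  proof -
    obtain B where "B \<subseteq> X" "ind_on E B" "card B = ?rk X" using basis_exists X by blast
    then show ?thesis using card_le_matroid_rank[of E B] X by auto
  qed
  \<comment> \<open>Since \<open>ann E\<close> has q^(m - rk E) elements, multiplying by its size
    turns each monomial evaluated at \<open>q\<close> into the size of an annihilator.\<close>
  have scaled: "q ^ (?rk E - ?rk X) * card (ann E) = card (ann X)" if X: "X \<subseteq> E" for X
  proof -
    have "q ^ (?rk E - ?rk X) * card (ann E) * q ^ ?rk X = card (ann E) * q ^ ?rk E"
      using rk_le[OF X] by (simp add: power_add[symmetric] mult.commute mult.left_commute)
    also have "\<dots> = card (ann X) * q ^ ?rk X"
      using card_ann_rank[OF E, of E] card_ann_rank[OF E X] by simp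
    finally show ?thesis using q_gt_1 by simp
  qed
  define V where "V = {..<m} \<rightarrow>\<^sub>E carrier F"
  have finV: "finite V" unfolding V_def using finite_carrier by (intro finite_PiE) auto
  define Z where "Z \<phi> = {e\<in>E. ev \<phi> e = \<zero>}" for \<phi>
  have annV: "ann X = {\<phi>\<in>V. X \<subseteq> Z \<phi>}" if "X \<subseteq> E" for X
    unfolding ann_def V_def Z_def using that by auto
  have "poly (char_poly_matroid E (ind_on E)) (int q) * int (card (ann E))
      = (\<Sum>X\<in>Pow E. (- 1) ^ card X * int (q ^ (?rk E - ?rk X) * card (ann E)))"
    unfolding char_poly_matroid_def
    by (simp add: poly_sum poly_monom sum_distrib_right mult.assoc)
  also have "\<dots> = (\<Sum>X\<in>Pow E. (- 1) ^ card X * int (card (ann X)))"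
    using scaled by (intro sum.cong) auto
  also have "\<dots> = (\<Sum>X\<in>Pow E. \<Sum>\<phi>\<in>{\<phi>\<in>V. X \<subseteq> Z \<phi>}. (- 1) ^ card X)"
    using annV by (intro sum.cong) auto
  \<comment> \<open>Double counting: \<phi> contributes to exactly those \<open>X\<close> on which
    it vanishes, the subsets of its nonempty zero set \<open>Z \<phi>\<close>.\<close>
  also have "\<dots> = (\<Sum>\<phi>\<in>V. \<Sum>X\<in>{X\<in>Pow E. X \<subseteq> Z \<phi>}. (- 1) ^ card X)"
    using E finV by (intro sum.swap_restrict) auto
  also have "\<dots> = (\<Sum>\<phi>\<in>V. \<Sum>X\<in>Pow (Z \<phi>). (- 1) ^ card X)"
    by (intro sum.cong refl) (auto simp: Z_def)
  also have "\<dots> = 0"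
  proof (rule sum.neutral, rule ballI)
    fix \<phi> assume "\<phi> \<in> V"
    then have "Z \<phi> \<noteq> {}" "finite (Z \<phi>)"
      using blocked E unfolding V_def Z_def by auto
    then show "(\<Sum>X\<in>Pow (Z \<phi>). (- 1) ^ card X) = (0 :: int)"
      by (intro sum_Pow_alternating)
  qed
  finally show ?thesis using card_ann_pos[of E] by simp
qed

section \<open>Normalised vectors as points of a projective space\<close>

definition normalised :: "'b \<Rightarrow> bool" where
  "normalised x \<longleftrightarrow> (\<exists>i<m. A i x = \<one> \<and> (\<forall>j<i. A j x = \<zero>))"

text \<open>Proportional vectors have their leading entries at the same index. Both entries are one
  there, so the scalars agree and cancel.\<close>

lemma normalised_scaled_eq:
  assumes "normalised x" "normalised y" "c \<in> carrier F - {\<zero>}" "d \<in> carrier F - {\<zero>}"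
    and eq: "\<And>i. i < m \<Longrightarrow> c \<otimes> A i x = d \<otimes> A i y"
  shows "c = d \<and> (\<forall>i<m. A i x = A i y)"
proof -
  obtain i where i: "i < m" "A i x = \<one>" "\<And>j. j < i \<Longrightarrow> A j x = \<zero>"
    using assms(1) unfolding normalised_def by blast
  obtain j where j: "j < m" "A j y = \<one>" "\<And>i. i < j \<Longrightarrow> A i y = \<zero>"
    using assms(2) unfolding normalised_def by blast
  have "\<not> i < j" using eq[OF i(1)] i(2) j(3)[of i] assms(3,4) by auto
  moreover have "\<not> j < i" using eq[OF j(1)] j(2) i(3)[of j] assms(3,4) by auto
  ultimately have "i = j" by simp
  then have "c = d" using eq[OF i(1)] i(2) j(2) assms(3,4) by simp
  then show ?thesis using eq entries assms(3) m_lcancel by auto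
qed

text \<open>A basis of \<open>X\<close> over the subfield \<open>K\<close> stays independent over \<open>F\<close> since its dual family
  does; the scalar multiples over \<open>K\<close> of the members of \<open>X\<close> are determined by their coordinates
  in it.\<close>

lemma card_normalised_le:
  assumes E: "finite E" "X \<subseteq> E" and K: "subfield K F"
    and ent: "\<And>i x. i < m \<Longrightarrow> x \<in> X \<Longrightarrow> A i x \<in> K"
    and norm: "\<And>x. x \<in> X \<Longrightarrow> normalised x"
    and inj: "\<And>x y. x \<in> X \<Longrightarrow> y \<in> X \<Longrightarrow> (\<And>i. i < m \<Longrightarrow> A i x = A i y) \<Longrightarrow> x = y"
  shows "(card K - 1) * card X + 1 \<le> card K ^ matroid_rank (ind_on E) X"
proof -
  interpret matroid E "ind_on E" by (rule matroid_ind_on[OF E(1)])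
  note sr = subfieldE(1)[OF K]
  note Kc = subfieldE(3)[OF K]
  have finX: "finite X" using E finite_subset by blast
  have finK: "finite K" using Kc finite_carrier finite_subset by blast
  \<comment> \<open>Maximality is taken over \<open>K\<close>, not over \<open>F\<close>: this is
    what puts the coordinates with respect to \<open>B\<close> into \<open>K\<close>.\<close>
  define S where "S = {B. B \<subseteq> X \<and> (\<exists>\<Phi>. dual K \<Phi> B)}"
  have "finite S" unfolding S_def using finX by auto
  moreover have "{} \<in> S" unfolding S_def dual_def by simp
  ultimately obtain B where B: "B \<in> S" "\<And>C. C \<in> S \<Longrightarrow> B \<subseteq> C \<Longrightarrow> B = C"
    using finite_has_maximal[of S] by blast
  then obtain \<Phi> where \<Phi>: "dual K \<Phi> B" and BX: "B \<subseteq> X" unfolding S_def by blast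
  have finB: "finite B" using BX finX finite_subset by blast
  have \<Phi>K: "ev (\<Phi> b) v \<in> K" if "b \<in> B" "v \<in> X" for b v
    using ev_in_subring[OF sr, of "\<Phi> b" v] \<Phi> ent that unfolding dual_def by blast
  have expand: "A i v = (\<Oplus>b\<in>B. ev (\<Phi> b) v \<otimes> A i b)" if v: "v \<in> X" and i: "i < m" for v i
  proof (cases "v \<in> B")
    case True
    have "(\<Oplus>b\<in>B. ev (\<Phi> b) v \<otimes> A i b) = (\<Oplus>b\<in>B. if v = b then A i b else \<zero>)"
      using \<Phi> True entries[OF i] unfolding dual_def by (intro finsum_cong') auto
    also have "\<dots> = A i v" using finB True entries[OF i] by (intro finsum_singleton) auto
    finally show ?thesis by simp
  next
    case False
    have "\<nexists>\<Phi>'. dual K \<Phi>' (insert v B)"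
      using B False v BX unfolding S_def by blast
    then show ?thesis
      using dual_extend_or_expand[OF K finB False \<Phi>] ent v BX i by blast
  qed
  define h where "h = (\<lambda>(c, v). \<lambda>b\<in>B. c \<otimes> ev (\<Phi> b) v)"
  have h: "c \<otimes> A i v = (\<Oplus>b\<in>B. h (c, v) b \<otimes> A i b)"
    if c: "c \<in> K" and v: "v \<in> X" and i: "i < m" for c v i
  proof -
    have "c \<otimes> A i v = (\<Oplus>b\<in>B. c \<otimes> (ev (\<Phi> b) v \<otimes> A i b))"
      unfolding expand[OF v i] using c Kc \<Phi>K[OF _ v] entries[OF i] finB
      by (intro finsum_rdistr) auto
    also have "\<dots> = (\<Oplus>b\<in>B. h (c, v) b \<otimes> A i b)"
    proof (rule finsum_cong', goal_cases)
      case (3 b)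
      then show ?case using c Kc \<Phi>K[OF _ v, of b] entries[OF i]
        by (simp add: h_def m_assoc subset_iff)
    next
      case 2
      then show ?case using c Kc \<Phi>K[OF _ v] entries[OF i]
        by (auto simp: h_def subset_iff)
    qed simp
    finally show ?thesis .
  qed
  have "inj_on h ((K - {\<zero>}) \<times> X)"
  proof (rule inj_onI)
    fix y z assume "y \<in> (K - {\<zero>}) \<times> X" "z \<in> (K - {\<zero>}) \<times> X" and "h y = h z"
    then obtain c v d w where y: "y = (c, v)" and z: "z = (d, w)"
      and c: "c \<in> K" "c \<noteq> \<zero>" and d: "d \<in> K" "d \<noteq> \<zero>" and v: "v \<in> X" and w: "w \<in> X"
      and eq: "h (c, v) = h (d, w)" by blast
    have "c \<otimes> A i v = d \<otimes> A i w" if "i < m" for i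
      using h[OF c(1) v that] h[OF d(1) w that] eq by simp
    then have "c = d \<and> (\<forall>i<m. A i v = A i w)"
      using c d Kc norm[OF v] norm[OF w] by (intro normalised_scaled_eq) auto
    then show "y = z" using inj[OF v w] y z by blast
  qed
  \<comment> \<open>The zero tuple is missed because a normalised vector has an entry one; it
    accounts for the \<open>+ 1\<close> in the bound.\<close>
  moreover have "h ` ((K - {\<zero>}) \<times> X) \<subseteq> (B \<rightarrow>\<^sub>E K) - {\<lambda>b\<in>B. \<zero>}"
  proof (rule image_subsetI)
    fix y assume "y \<in> (K - {\<zero>}) \<times> X"
    then obtain c v where y: "y = (c, v)" and c: "c \<in> K" "c \<noteq> \<zero>" and v: "v \<in> X" by blast
    have "h (c, v) \<in> B \<rightarrow>\<^sub>E K"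
      unfolding h_def using c(1) \<Phi>K[OF _ v] subringE(6)[OF sr] by auto
    moreover have "h (c, v) \<noteq> (\<lambda>b\<in>B. \<zero>)"
    proof
      assume z: "h (c, v) = (\<lambda>b\<in>B. \<zero>)"
      obtain i where i: "i < m" "A i v = \<one>" using norm[OF v] unfolding normalised_def by blast
      have "c \<otimes> A i v = \<zero>"
        unfolding h[OF c(1) v i(1)] z using entries[OF i(1)]
        by (subst finsum_cong'[of _ _ "\<lambda>_. \<zero>"]) auto
      then show False using c Kc i(2) by auto
    qed
    ultimately show "h y \<in> (B \<rightarrow>\<^sub>E K) - {\<lambda>b\<in>B. \<zero>}" using y by simp
  qed
  moreover have finBK: "finite (B \<rightarrow>\<^sub>E K)" using finB finK by (intro finite_PiE) auto
  ultimately have "card ((K - {\<zero>}) \<times> X) \<le> card ((B \<rightarrow>\<^sub>E K) - {\<lambda>b\<in>B. \<zero>})"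
    by (intro card_inj_on_le) auto
  moreover have zero_in: "(\<lambda>b\<in>B. \<zero>) \<in> B \<rightarrow>\<^sub>E K" using subringE(2)[OF sr] by auto
  have "Suc (card ((B \<rightarrow>\<^sub>E K) - {\<lambda>b\<in>B. \<zero>})) = card K ^ card B"
    using card.remove[OF finBK zero_in] finB by (simp only: card_PiE prod_constant)
  moreover have "card (K - {\<zero>}) = card K - 1"
    using subringE(2)[OF sr] by simp
  ultimately have "(card K - 1) * card X + 1 \<le> card K ^ card B"
    by (simp add: card_cartesian_product)
  also have "\<dots> \<le> card K ^ matroid_rank (ind_on E) X"
  proof (rule power_increasing)
    have "ind_on E B" using dual_mono[OF \<Phi> Kc] BX E(2) unfolding ind_on_def ind_def by blast
    then show "card B \<le> matroid_rank (ind_on E) X" using card_le_matroid_rank E(2) BX by blast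
    show "1 \<le> card K" using subringE(2)[OF sr] finK by (metis One_nat_def Suc_leI card_gt_0_iff empty_iff)
  qed
  finally show ?thesis .
qed

text \<open>The counting bound over all of \<open>F\<close> excludes a smaller rank: one point needs
  q^rank at least q, two points need at least 2q - 1, which exceeds q. The case \<open>x = y\<close>
  excludes loops.\<close>

lemma normalised_pair_ind:
  assumes "normalised x" "normalised y" "(\<And>i. i < m \<Longrightarrow> A i x = A i y) \<Longrightarrow> x = y"
  shows "ind {x, y}"
proof -
  interpret matroid "{x, y}" "ind_on {x, y}" by (rule matroid_ind_on) simp
  have "(q - 1) * card {x, y} + 1 \<le> q ^ matroid_rank (ind_on {x, y}) {x, y}"
    using assms entries by (intro card_normalised_le[OF _ _ carrier_is_subfield]) auto
  moreover obtain B where B: "B \<subseteq> {x, y}" "ind_on {x, y} B"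
    "card B = matroid_rank (ind_on {x, y}) {x, y}"
    using basis_exists by blast
  ultimately have le: "(q - 1) * card {x, y} + 1 \<le> q ^ card B" by simp
  have "card {x, y} \<le> card B"
  proof (rule ccontr)
    assume neg: "\<not> card {x, y} \<le> card B"
    have "card {x, y} \<le> 2" by (simp add: card_insert_if)
    then consider "card B = 0" "card {x, y} \<ge> 1" | "card B = 1" "card {x, y} = 2"
      using neg by linarith
    then show False using le q_gt_1 by cases auto
  qed
  then have "B = {x, y}" using card_seteq[OF _ B(1)] by simp
  then show ?thesis using B(2) unfolding ind_on_def by simp
qed

end

section \<open>Prime subfields and blocking sets\<close>

text \<open>The subfield consists of the integer multiples of one. The order of the additive group
  gives p^k times one equal to zero, and a field has no nonzero nilpotents, so p times one vanishes.
  Bezout supplies the inverses, and with them injectivity below \<open>p\<close>.\<close>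

lemma (in field) prime_subfield_exists:
  assumes p: "Factorial_Ring.prime p" and card: "card (carrier R) = p ^ k"
  obtains K where "subfield K R" "card K = p"
proof -
  define \<iota> where "\<iota> n = [n] \<cdot> \<one>" for n :: nat
  have \<iota>c [simp]: "\<iota> n \<in> carrier R" for n unfolding \<iota>_def by simp
  have \<iota>_add: "\<iota> (a + b) = \<iota> a \<oplus> \<iota> b" for a b
    unfolding \<iota>_def by (simp add: add.nat_pow_mult)
  have \<iota>_mult: "\<iota> (a * b) = \<iota> a \<otimes> \<iota> b" for a b
    unfolding \<iota>_def by (simp add: add_pow_ldistr add.nat_pow_pow mult.commute)
  have \<iota>_0: "\<iota> 0 = \<zero>" and \<iota>_1: "\<iota> 1 = \<one>" unfolding \<iota>_def by simp_all
  have \<iota>_power: "\<iota> (a ^ n) = \<iota> a [^] n" for a n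
    by (induction n) (simp_all add: \<iota>_1[simplified] \<iota>_mult m_comm)
  have "\<iota> (p ^ k) = \<zero>"
    using add.pow_order_eq_1[of \<one>] card unfolding \<iota>_def order_def by simp
  moreover have "x = \<zero>" if "x [^] n = \<zero>" "x \<in> carrier R" for x and n :: nat
    using that by (induction n) (auto simp: integral_iff)
  ultimately have \<iota>_p: "\<iota> p = \<zero>" unfolding \<iota>_power by simp
  have \<iota>_mod: "\<iota> (n mod p) = \<iota> n" for n
  proof -
    have "\<iota> n = \<iota> (p * (n div p) + n mod p)" by simp
    also have "\<dots> = \<iota> (n mod p)" unfolding \<iota>_add \<iota>_mult \<iota>_p by simp
    finally show ?thesis by simp
  qed
  have inverse: "\<exists>b. \<iota> a \<otimes> \<iota> b = \<one>" if "\<not> p dvd a" for a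
  proof -
    have "coprime a p" using prime_imp_coprime_nat[OF p that] by (simp add: coprime_commute)
    moreover have "a \<noteq> 0" using that by (metis dvd_0_right)
    ultimately obtain b c where "a * b = p * c + 1" using bezout_nat[of a p] by auto
    then have "\<iota> a \<otimes> \<iota> b = \<iota> p \<otimes> \<iota> c \<oplus> \<iota> 1" by (metis \<iota>_mult \<iota>_add)
    then have "\<iota> a \<otimes> \<iota> b = \<one>" unfolding \<iota>_p \<iota>_1 by simp
    then show ?thesis by blast
  qed
  have K: "range \<iota> = \<iota> ` {..<p}"
    using \<iota>_mod p by (auto simp: image_iff) (metis lessThan_iff mod_less_divisor prime_gt_0_nat)
  have "subring (range \<iota>) R"
  proof (rule subringI)
    show "\<one> \<in> range \<iota>" using \<iota>_1 by (metis rangeI)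
    show "\<ominus> h \<in> range \<iota>" if h: "h \<in> range \<iota>" for h
    proof -
      obtain n where n: "h = \<iota> n" using h by blast
      have "\<iota> (n * (p - 1)) \<oplus> \<iota> n = \<iota> (n * p)"
        unfolding \<iota>_add[symmetric] using prime_gt_0_nat[OF p]
        by (intro arg_cong[of _ _ \<iota>]) (simp add: algebra_simps diff_mult_distrib2)
      also have "\<dots> = \<zero>" unfolding \<iota>_mult \<iota>_p by simp
      finally have "\<ominus> h = \<iota> (n * (p - 1))" using n minus_equality by simp
      then show ?thesis by blast
    qed
    show "h1 \<otimes> h2 \<in> range \<iota>" "h1 \<oplus> h2 \<in> range \<iota>" if "h1 \<in> range \<iota>" "h2 \<in> range \<iota>" for h1 h2
      using that by (auto simp flip: \<iota>_mult \<iota>_add)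
  qed auto
  moreover have "inv h \<in> range \<iota>" if h: "h \<in> range \<iota> - {\<zero>}" for h
  proof -
    obtain a where a: "h = \<iota> a" "\<iota> a \<noteq> \<zero>" using h by blast
    have "\<not> p dvd a" using a(2) \<iota>_mult \<iota>_p by (auto elim!: dvdE)
    then obtain b where "\<iota> a \<otimes> \<iota> b = \<one>" using inverse by blast
    then have "inv h = \<iota> b" using a(1) comm_inv_char[of h "\<iota> b"] by simp
    then show ?thesis by blast
  qed
  ultimately have "subfield (range \<iota>) R" by (rule subfieldI')
  moreover have "inj_on \<iota> {..<p}"
  proof (rule linorder_inj_onI)
    fix a b assume ab: "a < b" "a \<in> {..<p}" "b \<in> {..<p}"
    then have "\<not> p dvd (b - a)" by (auto dest: dvd_imp_le)
    then obtain c where c: "\<iota> (b - a) \<otimes> \<iota> c = \<one>" using inverse by blast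
    show "\<iota> a \<noteq> \<iota> b"
    proof
      assume "\<iota> a = \<iota> b"
      moreover have "\<iota> b = \<iota> a \<oplus> \<iota> (b - a)" unfolding \<iota>_add[symmetric] using ab by simp
      ultimately have "\<iota> a \<oplus> \<iota> (b - a) = \<iota> a" by simp
      then have "\<iota> (b - a) = \<zero>" by simp
      then show False using c by simp
    qed
  qed auto
  then have "card (range \<iota>) = p" unfolding K by (simp add: card_image)
  ultimately show ?thesis using that by blast
qed

text \<open>All parallel classes are singletons, so the choice of representatives returns the whole
  ground set.\<close>

lemma matroid_a_simple:
  assumes "matroid_simple E indep" "\<And>X. indep X \<Longrightarrow> X \<subseteq> E"
  shows "matroid_a E indep = indep_cover_number E indep"
proof -
  have nl: "{e\<in>E. \<not> matroid_loop indep e} = E"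
    using assms(1) unfolding matroid_simple_def by blast
  then have "parallel_rel E indep = Id_on E"
    using assms(1) unfolding matroid_simple_def parallel_rel_def nl by auto
  then have "{e\<in>E. \<not> matroid_loop indep e} // parallel_rel E indep = (\<lambda>e. {e}) ` E"
    unfolding nl quotient_def by auto
  then have g: "si_ground E indep = E"
    unfolding si_ground_def by (simp add: image_image)
  then have "si_indep E indep = indep"
    unfolding si_indep_def fun_eq_iff using assms(2) by auto
  then show ?thesis unfolding matroid_a_def g by simp
qed

text \<open>Cross-multiplied monotonicity of (p^j - 1) / j, which reduces Edmonds' inequality to
  full rank. In the induction the extra p^j - 1 is at most j * p^n, and 2 * p^n is at most p^(n +
  1).\<close>

lemma geometric_quotient_mono:
  fixes p :: nat
  assumes "2 \<le> p" "j \<le> n"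
  shows "n * (p ^ j - 1) \<le> j * (p ^ n - 1)"
  using assms(2)
proof (induction n rule: dec_induct)
  case base
  then show ?case by simp
next
  case (step n)
  show ?case
  proof (cases "j = 0")
    case True
    then show ?thesis by simp
  next
    case False
    have "p ^ j \<le> p ^ n" using step.hyps assms(1) by (intro power_increasing) auto
    then have "p ^ j - 1 \<le> j * p ^ n" using False
      by (metis One_nat_def Suc_leI diff_le_self le_trans mult_le_mono1 nat_mult_1 neq0_conv)
    then have "Suc n * (p ^ j - 1) \<le> j * (p ^ n - 1) + j * p ^ n" using step.IH by simp
    also have "\<dots> = j * (2 * p ^ n - 1)"
      using assms(1) by (simp add: algebra_simps diff_mult_distrib2)
    also have "\<dots> \<le> j * (p ^ Suc n - 1)"
      using assms(1) by (intro mult_le_mono2 diff_le_mono) simp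
    finally show ?thesis .
  qed
qed

text \<open>By pigeonhole two distinct vectors over \<open>K\<close> have the same value under \<open>\<phi>\<close>; their
  difference, normalised, is the required point.\<close>

lemma (in vector_family) subfield_points_block:
  assumes K: "subfield K F" and big: "card (carrier F) < card K ^ m"
    and \<phi>: "\<phi> \<in> {..<m} \<rightarrow> carrier F"
    and all: "\<And>v. v \<in> {..<m} \<rightarrow>\<^sub>E K \<Longrightarrow> \<exists>i<m. v i = \<one> \<and> (\<forall>j<i. v j = \<zero>) \<Longrightarrow>
      \<exists>e\<in>E. \<forall>i<m. A i e = v i"
  shows "\<exists>e\<in>E. ev \<phi> e = \<zero>"
proof -
  note sr = subfieldE(1)[OF K]
  note Kc = subfieldE(3)[OF K]
  have finK: "finite K" using Kc finite_carrier finite_subset by blast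
  \<comment> \<open>\<open>ev \<phi>\<close> only accepts columns, whereas pigeonhole runs over all
    vectors with entries in \<open>K\<close>.\<close>
  define L where "L u = (\<Oplus>i\<in>{..<m}. \<phi> i \<otimes> u i)" for u
  have "L ` ({..<m} \<rightarrow>\<^sub>E K) \<subseteq> carrier F"
    unfolding L_def using \<phi> Kc by (auto intro!: finsum_closed)
  moreover have "card ({..<m} \<rightarrow>\<^sub>E K) = card K ^ m" by (simp add: card_PiE)
  ultimately have "\<not> inj_on L ({..<m} \<rightarrow>\<^sub>E K)"
    using big card_inj_on_le[OF _ _ finite_carrier, of L] by (metis not_le)
  then obtain u w where u: "u \<in> {..<m} \<rightarrow>\<^sub>E K" and w: "w \<in> {..<m} \<rightarrow>\<^sub>E K" and "u \<noteq> w" "L u = L w"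
    unfolding inj_on_def by blast
  define d where "d i = u i \<ominus> w i" for i
  have uc: "u i \<in> carrier F" and wc: "w i \<in> carrier F" and dK: "d i \<in> K" if "i < m" for i
    using PiE_mem[OF u, of i] PiE_mem[OF w, of i] Kc that subringE(5,7)[OF sr]
    unfolding d_def a_minus_def by auto
  have "\<exists>i. i < m \<and> d i \<noteq> \<zero>"
  proof (rule ccontr)
    assume "\<not> ?thesis"
    then have "u i = w i" if "i < m" for i using that uc wc unfolding d_def by auto
    then have "u = w" using u w by (intro PiE_ext[of u _ "\<lambda>_. K"]) auto
    then show False using \<open>u \<noteq> w\<close> by simp
  qed
  then obtain i where i: "i < m" "d i \<noteq> \<zero>" and least: "\<And>j. j < i \<Longrightarrow> \<not> (j < m \<and> d j \<noteq> \<zero>)"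
    using exists_least_iff[of "\<lambda>i. i < m \<and> d i \<noteq> \<zero>"] by blast
  define c where "c = inv (d i)"
  have c: "c \<in> K" "c \<otimes> d i = \<one>" "c \<in> carrier F"
    using subfield_m_inv[OF K, of "d i"] dK[OF i(1)] i(2) Kc unfolding c_def by auto
  define v where "v = (\<lambda>j\<in>{..<m}. c \<otimes> d j)"
  have "v \<in> {..<m} \<rightarrow>\<^sub>E K" unfolding v_def using c(1) dK subringE(6)[OF sr] by auto
  moreover have "v i = \<one> \<and> (\<forall>j<i. v j = \<zero>)"
    unfolding v_def using i(1) c least by auto
  ultimately obtain e where e: "e \<in> E" "\<And>j. j < m \<Longrightarrow> A j e = v j" using all i(1) by blast
  \<comment> \<open>By linearity this is \<open>c\<close> times the difference of \<open>L u\<close>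
    and \<open>L w\<close>; that difference is split as a sum with scalar
    \<open>\<ominus> \<one>\<close>.\<close>
  have "ev \<phi> e = (\<Oplus>j\<in>{..<m}. c \<otimes> (\<phi> j \<otimes> u j \<ominus> \<phi> j \<otimes> w j))"
    unfolding ev_def
  proof (rule finsum_cong', goal_cases)
    case (3 j)
    then have j: "j < m" "\<phi> j \<in> carrier F" using \<phi> by auto
    have "A j e = c \<otimes> (u j \<ominus> w j)" using e(2)[OF j(1)] j(1) by (simp add: v_def d_def)
    then show ?case using j c(3) uc[OF j(1)] wc[OF j(1)] by (simp only:) algebra
  qed (use \<phi> c(3) uc wc in \<open>auto simp: Pi_iff\<close>)
  also have "\<dots> = c \<otimes> (\<Oplus>j\<in>{..<m}. \<phi> j \<otimes> u j \<ominus> \<phi> j \<otimes> w j)"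
    using \<phi> c(3) uc wc by (intro finsum_rdistr[symmetric]) (auto simp: Pi_iff)
  also have "(\<Oplus>j\<in>{..<m}. \<phi> j \<otimes> u j \<ominus> \<phi> j \<otimes> w j) = (\<Oplus>j\<in>{..<m}. \<phi> j \<otimes> u j \<oplus> (\<ominus> \<one>) \<otimes> (\<phi> j \<otimes> w j))"
    using \<phi> uc wc by (intro finsum_cong') (auto simp: a_minus_def l_minus Pi_iff)
  also have "\<dots> = L u \<oplus> (\<Oplus>j\<in>{..<m}. (\<ominus> \<one>) \<otimes> (\<phi> j \<otimes> w j))"
    unfolding L_def using \<phi> uc wc by (intro finsum_addf) (auto simp: Pi_iff)
  also have "(\<Oplus>j\<in>{..<m}. (\<ominus> \<one>) \<otimes> (\<phi> j \<otimes> w j)) = (\<ominus> \<one>) \<otimes> L w"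
    unfolding L_def using \<phi> wc by (intro finsum_rdistr[symmetric]) (auto simp: Pi_iff)
  finally have "ev \<phi> e = c \<otimes> (L u \<oplus> (\<ominus> \<one>) \<otimes> L w)" .
  moreover have "L w \<in> carrier F" unfolding L_def using \<phi> wc by (intro finsum_closed) (auto simp: Pi_iff)
  ultimately show ?thesis using e(1) \<open>L u = L w\<close> c(3) by (auto simp: l_minus r_neg)
qed


text \<open>Take a maximal set between \<open>E0\<close> and \<open>U\<close> that \<open>r\<close>
  independent sets can cover. If fewer sufficed, it would not be \<open>U\<close>, and a further
  point could be covered by its own singleton, against maximality.\<close>

lemma superset_with_cover_number:
  assumes U: "finite U" "E0 \<subseteq> U" and single: "\<And>x. x \<in> U \<Longrightarrow> indep {x}"
    and upper: "finite C0" "card C0 \<le> r" "\<And>X. X \<in> C0 \<Longrightarrow> indep X" "\<Union>C0 = E0"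
    and lower: "\<And>C. finite C \<Longrightarrow> card C < r \<Longrightarrow> (\<And>X. X \<in> C \<Longrightarrow> indep X) \<Longrightarrow> \<Union>C \<noteq> U"
  obtains E where "E0 \<subseteq> E" "E \<subseteq> U" "indep_cover_number E indep = r"
proof -
  define covers where "covers E C \<longleftrightarrow> finite C \<and> (\<forall>X\<in>C. indep X) \<and> \<Union>C = E" for E C
  define S where "S = {E. E0 \<subseteq> E \<and> E \<subseteq> U \<and> (\<exists>C. covers E C \<and> card C \<le> r)}"
  have "finite S" unfolding S_def using U(1) by auto
  moreover have "E0 \<in> S" unfolding S_def covers_def using U upper by blast
  ultimately obtain E where E: "E \<in> S" "\<And>E'. E' \<in> S \<Longrightarrow> E \<subseteq> E' \<Longrightarrow> E = E'"
    using finite_has_maximal[of S] by blast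
  then obtain C where C: "covers E C" "card C \<le> r" and EU: "E0 \<subseteq> E" "E \<subseteq> U"
    unfolding S_def by blast
  have ge: "r \<le> card D" if D: "covers E D" for D
  proof (rule ccontr)
    assume less: "\<not> r \<le> card D"
    then have "E \<noteq> U" using lower[of D] D unfolding covers_def by auto
    then obtain x where x: "x \<in> U" "x \<notin> E" using EU by blast
    have "covers (insert x E) (insert {x} D)"
      using D single[OF x(1)] unfolding covers_def by auto
    moreover have "card (insert {x} D) \<le> r"
      using less D unfolding covers_def by (simp add: card_insert_if)
    ultimately have "insert x E \<in> S" unfolding S_def using x EU by blast
    then show False using E(2)[of "insert x E"] x by blast
  qed
  have "indep_cover_number E indep = r"
    unfolding indep_cover_number_def
  proof (rule Least_equality)
    show "\<exists>C. finite C \<and> card C = r \<and> (\<forall>X\<in>C. indep X) \<and> \<Union>C = E"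
      using C ge[OF C(1)] unfolding covers_def by auto
    show "r \<le> n" if "\<exists>C. finite C \<and> card C = n \<and> (\<forall>X\<in>C. indep X) \<and> \<Union>C = E" for n
      using that ge unfolding covers_def by blast
  qed
  then show ?thesis using that EU by blast
qed

section \<open>The point set with cover number \<open>r\<close>\<close>

theorem corollary7p2:
  fixes p k r :: nat and F :: "('f, 'm) ring_scheme"
  assumes "Factorial_Ring.prime p"
    and "k \<ge> 3 \<or> (k = 2 \<and> p \<ge> 5)"
    and "d_bound p k \<le> int r"
    and "int r \<le> \<lfloor>real (p ^ k) / 2\<rfloor>"
    and "Ring.field F" and "card (carrier F) = p ^ k"
  shows "\<exists>(E :: nat set) indep.
           matroid E indep \<and> matroid_simple E indep \<and> matroid_representable F E indep \<and>
           matroid_a E indep = r \<and>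
           int (p ^ k) > 2 * int r - 1 \<and>
           poly (char_poly_matroid E indep) (int (p ^ k)) = 0"
proof -
  interpret F: field F by fact
  have p: "2 \<le> p" using assms(1) by (rule prime_ge_2_nat)
  have k: "2 \<le> k" using assms(2) by auto
  have r2: "2 * r \<le> p ^ k"
  proof -
    have "real r \<le> real (p ^ k) / 2" using assms(4) by (simp add: le_floor_iff)
    then have "real (2 * r) \<le> real (p ^ k)" by simp
    then show ?thesis by (simp only: of_nat_le_iff)
  qed
  \<comment> \<open>\<open>d_bound\<close> with denominators cleared: Edmonds' inequality for all of
    PG(k, p).\<close>
  have r1: "p ^ (k + 1) - 1 \<le> r * (k + 1) * (p - 1)"
  proof -
    have "(real p ^ (k + 1) - 1) / (real (k + 1) * (real p - 1)) \<le> real r"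
      using assms(3) unfolding d_bound_def by (simp add: ceiling_le_iff)
    moreover have "0 < real (k + 1) * (real p - 1)" using p by simp
    ultimately have "real p ^ (k + 1) - 1 \<le> real r * (real (k + 1) * (real p - 1))"
      by (simp only: pos_divide_le_eq)
    also have "real p - 1 = real (p - 1)" using p by (simp add: of_nat_diff)
    also have "real r * (real (k + 1) * real (p - 1)) = real (r * (k + 1) * (p - 1))"
      by (simp only: of_nat_mult mult.assoc)
    finally have "real (p ^ (k + 1)) \<le> real (r * (k + 1) * (p - 1) + 1)" by simp
    then show ?thesis unfolding of_nat_le_iff by simp
  qed
  have finF: "finite (carrier F)"
    using assms(6) p by (metis card.infinite not_numeral_le_zero power_not_zero)
  obtain K where K: "subfield K F" "card K = p"
    using F.prime_subfield_exists[OF assms(1,6)] by blast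
  define m where "m = k + 1"
  define P where "P = {v \<in> {..<m} \<rightarrow>\<^sub>E carrier F. \<exists>i<m. v i = \<one>\<^bsub>F\<^esub> \<and> (\<forall>j<i. v j = \<zero>\<^bsub>F\<^esub>)}"
  have finP: "finite P"
    unfolding P_def using finF by (simp add: finite_PiE)
  \<comment> \<open>The points whose coordinate 0 is one already number q^k, which is enough for the
    lower bound on covers.\<close>
  have cardP: "(p ^ k) ^ k \<le> card P"
  proof -
    define f where "f u = (\<lambda>i\<in>{..<m}. if i = 0 then \<one>\<^bsub>F\<^esub> else u (i - 1))" for u
    have f: "f u \<in> P" if "u \<in> {..<k} \<rightarrow>\<^sub>E carrier F" for u
    proof -
      have "f u \<in> {..<m} \<rightarrow>\<^sub>E carrier F"
        unfolding f_def m_def using PiE_mem[OF that] by auto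
      moreover have "\<exists>i<m. f u i = \<one>\<^bsub>F\<^esub> \<and> (\<forall>j<i. f u j = \<zero>\<^bsub>F\<^esub>)"
        unfolding f_def m_def by (intro exI[of _ 0]) simp
      ultimately show ?thesis by (simp add: P_def)
    qed
    have "inj_on f ({..<k} \<rightarrow>\<^sub>E carrier F)"
    proof (rule inj_onI)
      fix u w assume u: "u \<in> {..<k} \<rightarrow>\<^sub>E carrier F" and w: "w \<in> {..<k} \<rightarrow>\<^sub>E carrier F"
        and eq: "f u = f w"
      show "u = w"
      proof (rule PiE_ext[OF u w])
        fix i assume "i \<in> {..<k}"
        then show "u i = w i" using fun_cong[OF eq, of "Suc i"] unfolding f_def m_def by simp
      qed
    qed
    then have "card ({..<k} \<rightarrow>\<^sub>E carrier F) \<le> card P"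
      using f finP by (intro card_inj_on_le[of f]) auto
    then show ?thesis using assms(6) by (simp add: card_PiE)
  qed
  define N where "N = card P"
  obtain h where h: "bij_betw h {0..<N} P"
    using ex_bij_betw_nat_finite[OF finP] unfolding N_def by blast
  \<comment> \<open>The locale demands field entries at every index, so columns from
    \<open>N\<close> on are padded with zeros.\<close>
  define A where "A i e = (if e < N then h e i else \<zero>\<^bsub>F\<^esub>)" for i e
  have hP: "h e \<in> P" if "e < N" for e
    using h that unfolding bij_betw_def by auto
  have hm: "h e \<in> {..<m} \<rightarrow>\<^sub>E carrier F" if "e < N" for e
    using hP[OF that] unfolding P_def by simp
  interpret vector_family F m A
  proof
    show "A i e \<in> carrier F" if "i < m" for i e
      using PiE_mem[OF hm, of e i] that unfolding A_def by simp
  qed (rule finF)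
  have norm: "normalised e" if "e < N" for e
    using hP[OF that] that unfolding P_def normalised_def A_def by simp
  have inj: "x = y" if "x < N" "y < N" "\<And>i. i < m \<Longrightarrow> A i x = A i y" for x y
  proof -
    have "h x = h y" using hm that unfolding A_def by (intro PiE_ext[OF hm hm]) auto
    then show ?thesis using h that unfolding bij_betw_def inj_on_def by auto
  qed
  have pair: "ind {x, y}" if "x < N" "y < N" for x y
    using normalised_pair_ind norm inj that by blast
  define E0 where "E0 = {e. e < N \<and> (\<forall>i<m. A i e \<in> K)}"
  have E0: "finite E0" "E0 \<subseteq> {..<N}" unfolding E0_def by auto
  interpret M0: matroid E0 "ind_on E0" by (rule matroid_ind_on[OF E0(1)])
  \<comment> \<open>With \<open>j\<close> the rank of \<open>X\<close>, the counting bound gives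
    (p^j - 1) / (p - 1) as an upper bound for \<open>card X\<close>, and monotonicity together with
    \<open>r1\<close> bounds this by \<open>r * j\<close>.\<close>
  have "card X \<le> r * matroid_rank (ind_on E0) X" if X: "X \<subseteq> E0" for X
  proof -
    define j where "j = matroid_rank (ind_on E0) X"
    obtain B where "ind_on E0 B" "card B = j"
      using M0.basis_exists[OF X] unfolding j_def by blast
    then have "j \<le> m" using card_ind_le M0.finite_indep unfolding ind_on_def by blast
    then have "m * (p ^ j - 1) \<le> j * (p ^ m - 1)" by (rule geometric_quotient_mono[OF p])
    also have "\<dots> \<le> j * (r * m * (p - 1))" using r1 unfolding m_def by (intro mult_le_mono2)
    finally have "m * (p ^ j - 1) \<le> m * (r * j * (p - 1))" by (simp only: mult_ac)
    moreover have "0 < m" unfolding m_def by simp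
    ultimately have "p ^ j - 1 \<le> r * j * (p - 1)" by simp
    moreover have "(p - 1) * card X + 1 \<le> p ^ j"
      using card_normalised_le[OF E0(1) X K(1)] K(2) X norm inj unfolding j_def E0_def by blast
    ultimately have "(p - 1) * card X \<le> r * j * (p - 1)" by linarith
    then have "(p - 1) * card X \<le> (p - 1) * (r * j)" by (simp only: mult.commute)
    moreover have "0 < p - 1" using p by simp
    ultimately show ?thesis unfolding j_def by simp
  qed
  from M0.covering_by_indep_sets[OF this]
  obtain C0 where C0: "finite C0" "card C0 \<le> r" "\<forall>X\<in>C0. ind_on E0 X" "\<Union>C0 = E0"
    by blast
  \<comment> \<open>Fewer than \<open>r\<close> independent sets contain fewer than r * (k + 1)
    points. Both factors are at most q, and q^2 is at most q^k, hence at most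
    \<open>N\<close>.\<close>
  have lower: "\<Union>C \<noteq> {..<N}"
    if C: "finite C" "card C < r" "\<And>X. X \<in> C \<Longrightarrow> ind X" for C
  proof
    assume U: "\<Union>C = {..<N}"
    have "card X \<le> m" if "X \<in> C" for X
    proof (rule card_ind_le)
      show "finite X" using U that by (metis Union_upper finite_lessThan finite_subset)
    qed (use C that in blast)
    then have "N \<le> card C * m"
      using card_Union_le_sum_card[of C] sum_bounded_above[of C card m] U by simp
    also have "\<dots> < r * m" using C(2) by (intro mult_less_mono1) (simp_all add: m_def)
    also have "\<dots> \<le> p ^ k * p ^ k"
    proof (rule mult_le_mono)
      have "k < 2 ^ k" by (rule less_exp)
      also have "2 ^ k \<le> p ^ k" using p by (rule power_mono) simp
      finally show "m \<le> p ^ k" unfolding m_def by simp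
    qed (use r2 in simp)
    also have "\<dots> = (p ^ k) ^ 2" by (simp only: power2_eq_square)
    also have "\<dots> \<le> (p ^ k) ^ k" using k p by (intro power_increasing) auto
    finally show False using cardP unfolding N_def by simp
  qed
  obtain E where E: "E0 \<subseteq> E" "E \<subseteq> {..<N}" "indep_cover_number E ind = r"
  proof (rule superset_with_cover_number[of "{..<N}" E0 ind C0 r])
    show "ind {x}" if "x \<in> {..<N}" for x using pair[of x x] that by simp
  qed (use E0 C0 lower in \<open>auto simp: ind_on_def\<close>)
  have finE: "finite E" using E(2) finite_subset by blast
  have simple: "matroid_simple E (ind_on E)"
    using pair[of x x for x] pair E(2)
    unfolding matroid_simple_def matroid_parallel_def matroid_loop_def ind_on_def by auto
  \<comment> \<open>\<open>E\<close> was found using \<open>ind\<close>, which names no ground set;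
    members of a cover of \<open>E\<close> lie in \<open>E\<close> anyway.\<close>
  have "(\<forall>X\<in>C. ind_on E X) \<and> \<Union>C = E \<longleftrightarrow> (\<forall>X\<in>C. ind X) \<and> \<Union>C = E" for C
    unfolding ind_on_def by blast
  then have "indep_cover_number E (ind_on E) = indep_cover_number E ind"
    unfolding indep_cover_number_def by simp
  then have "matroid_a E (ind_on E) = r"
    using matroid_a_simple[OF simple] E(3) unfolding ind_on_def by simp
  moreover have "poly (char_poly_matroid E (ind_on E)) (int (card (carrier F))) = 0"
  proof (rule char_poly_zero[OF finE])
    fix \<phi> assume \<phi>: "\<phi> \<in> {..<m} \<rightarrow>\<^sub>E carrier F"
    show "\<exists>e\<in>E. ev \<phi> e = \<zero>\<^bsub>F\<^esub>"
    proof (rule subfield_points_block[OF K(1)])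
      show "card (carrier F) < card K ^ m" using K(2) assms(6) p unfolding m_def by simp
      show "\<phi> \<in> {..<m} \<rightarrow> carrier F" using \<phi> by auto
      fix v assume v: "v \<in> {..<m} \<rightarrow>\<^sub>E K" "\<exists>i<m. v i = \<one>\<^bsub>F\<^esub> \<and> (\<forall>j<i. v j = \<zero>\<^bsub>F\<^esub>)"
      then have "v \<in> P" unfolding P_def using subfieldE(3)[OF K(1)] by auto
      then obtain e where e: "e < N" "h e = v" using h unfolding bij_betw_def by auto
      then have "e \<in> E0" unfolding E0_def A_def using v(1) by auto
      then show "\<exists>e\<in>E. \<forall>i<m. A i e = v i" using E(1) e unfolding A_def by auto
    qed
  qed
  moreover have "2 * int r - 1 < int (p ^ k)" using r2 by linarith
  ultimately show ?thesis
    using matroid_ind_on[OF finE] simple representable_ind_on[OF finE] assms(6) by metis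
qed

end
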